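(* Let $d\ge1$, let $\alpha=(\alpha_1,\dots,\alpha_d)$ with $\alpha_j>-1$ for all $j$, let $\mu$ be the measure on $\mathbb{R}^d_+$ with density $W^L_\alpha(x)=\prod_{j=1}^d x_j^{\alpha_j}e^{-x_j}$ with respect to Lebesgue measure, and let $(\Omega_n)_n$, $(\alpha_{\cdot|n})_n$ be its Jacobi sequences. For all $n\in\mathbb{N}$ and $\overline{i}_n=cl\big((i_1,\dots,i_n)\big)$, $\overline{j}_n=cl\big((j_1,\dots,j_n)\big)\in\mathcal{A}_n$, put $n_l=\sharp\{k\in\{1,\dots,n\}: i_k=l\}$ for $1\le l\le d$, $\overline{n}=(n_1,\dots,n_d)$ and $\overline n!=n_1!\cdots n_d!$. Then for every $l\in\{1,\dots,d\}$ $$\alpha_{e_l|n}e_{\overline{i}_n}=(2n_l+\alpha_l+1)\,e_{\overline{i}_n},$$ and the coefficients $\lambda_{\overline{i}_n,\overline{j}_n}$ of $\Omega_n$ in the basis $(e_{\overline{i}_n})_{\overline{i}_n\in\mathcal{A}_n}$ of $(\mathbb{C}^d)^{\hat\otimes n}$ are given by $$\lambda_{\overline{i}_n,\overline{j}_n}=\delta_{\overline{i}_n,\overline{j}_n}\,\overline{n}!\prod_{l=1}^d\Gamma(n_l+\alpha_l+1).$$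
   Context: $\mathbb{N}=\{0,1,2,\dots\}$. Let $\mathcal{P}=\mathbb{C}[X_1,\dots,X_d]$, and let $\mathcal{P}_{n]}$ be the polynomials of degree at most $n$, $\mathcal{P}_{-1]}=\{0\}$. Let $\langle P,Q\rangle_\mu=\int\overline{P}\,Q\,d\mu$. Let $\mathcal{P}_n$ be the $\langle\cdot,\cdot\rangle_\mu$-orthogonal complement of $\mathcal{P}_{n-1]}$ in $\mathcal{P}_{n]}$, and $P_n:\mathcal{P}\to\mathcal{P}_n$ the orthogonal projection. For $v=(v_1,\dots,v_d)\in\mathbb{C}^d$ let $X_v=\sum_j v_jX_j$ (multiplication operator), $a^+_v=\sum_n P_{n+1}X_vP_n$ on $\mathcal{P}$, and $a^0_{v|n}=P_nX_vP_n|_{\mathcal{P}_n}:\mathcal{P}_n\to\mathcal{P}_n$. $(\mathbb{C}^d)^{\hat\otimes n}$ is the space of symmetric tensors of order $n$, $v_n\hat\otimes\cdots\hat\otimes v_1$ is the symmetrization of $v_n\otimes\cdots\otimes v_1$, and the tensor scalar product satisfies $\langle u^{\otimes n},v^{\otimes n}\rangle=\langle u,v\rangle_{\mathbb{C}^d}^n$ with the standard scalar product on $\mathbb{C}^d$. The linear isomorphism $U_n:(\mathbb{C}^d)^{\hat\otimes n}\to\mathcal{P}_n$ is given by $U_n(v_n\hat\otimes\cdots\hat\otimes v_1)=a^+_{v_n}\cdots a^+_{v_1}1$, $U_0(z)=z\cdot1$. The Jacobi sequences are: $\Omega_n$, the linear operator on $(\mathbb{C}^d)^{\hat\otimes n}$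 with $\langle\xi,\Omega_n\eta\rangle_{(\mathbb{C}^d)^{\hat\otimes n}}=\langle U_n\xi,U_n\eta\rangle_\mu$; and $\alpha_{v|n}=U_n^{-1}a^0_{v|n}U_n$, $v\in\mathbb{C}^d$ (the operators $\alpha_{v|n}$ are not to be confused with the parameters $\alpha_l$). Let $(e_1,\dots,e_d)$ be the canonical basis of $\mathbb{C}^d$. Two tuples in $\{1,\dots,d\}^n$ are equivalent if every $l\in\{1,\dots,d\}$ occurs the same number of times in both; $cl(\cdot)$ denotes the equivalence class and $\mathcal{A}_n$ the set of classes. For $\overline{j}_n=cl((j_1,\dots,j_n))$ put $e_{\overline{j}_n}=e_{j_1}\hat\otimes\cdots\hat\otimes e_{j_n}$. The coefficients of $\Omega_n$ in this basis mean $\lambda_{\overline{i}_n,\overline{j}_n}=\langle e_{\overline{i}_n},\Omega_n e_{\overline{j}_n}\rangle_{(\mathbb{C}^d)^{\hat\otimes n}}$. $\delta$ is the Kronecker symbol and $\Gamma$ the Gamma function. *)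

theory Defs
  imports
    "HOL-Analysis.Analysis"
    "HOL-Combinatorics.Combinatorics"
    "HOL-Library.Poly_Mapping"
    "HOL-Library.Groups_Big_Fun"
    "HOL-Library.FuncSet"
begin

text \<open>The index set \<open>{1, \<dots>, d}\<close> is the finite type \<open>'n\<close>. A polynomial is a finitely supported
  family of coefficients indexed by exponent vectors; its product is the convolution product
  of \<^theory>\<open>HOL-Library.Poly_Mapping\<close>.\<close>

type_synonym 'n polyC = "('n \<Rightarrow>\<^sub>0 nat) \<Rightarrow>\<^sub>0 complex"

definition Const :: "complex \<Rightarrow> 'n polyC" where
  "Const c = Poly_Mapping.single 0 c"

definition Xvar :: "'n \<Rightarrow> 'n polyC" where
  "Xvar j = Poly_Mapping.single (Poly_Mapping.single j 1) 1"

definition Xvec :: "complex ^ 'n \<Rightarrow> 'n::finite polyC" where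
  "Xvec v = (\<Sum>j\<in>UNIV. Const (v $ j) * Xvar j)"

definition eval_poly :: "'n::finite polyC \<Rightarrow> real ^ 'n \<Rightarrow> complex" where
  "eval_poly p x = (\<Sum>m\<in>Poly_Mapping.keys p.
     Poly_Mapping.lookup p m * (\<Prod>j\<in>UNIV. complex_of_real (x $ j) ^ Poly_Mapping.lookup m j))"

text \<open>The degree bound is an integer, so that \<open>polys_upto (-1) = {0}\<close>.\<close>

definition polys_upto :: "int \<Rightarrow> 'n::finite polyC set" where
  "polys_upto k = {p. \<forall>m\<in>Poly_Mapping.keys p. int (\<Sum>j\<in>UNIV. Poly_Mapping.lookup m j) \<le> k}"

text \<open>All notions below are meant for measures on \<open>\<real>\<^sup>d\<close> with finite moments of all orders for
  which \<open>inner_mu M\<close> is positive definite on polynomials; otherwise the Bochner integrals and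
  definite descriptions may take default values.\<close>

definition inner_mu :: "(real ^ 'n) measure \<Rightarrow> 'n::finite polyC \<Rightarrow> 'n polyC \<Rightarrow> complex" where
  "inner_mu M p q = (\<integral>x. cnj (eval_poly p x) * eval_poly q x \<partial>M)"

definition ortho_polys :: "(real ^ 'n) measure \<Rightarrow> nat \<Rightarrow> 'n::finite polyC set" where
  "ortho_polys M n =
     {p \<in> polys_upto (int n). \<forall>q\<in>polys_upto (int n - 1). inner_mu M q p = 0}"

definition ortho_proj :: "(real ^ 'n) measure \<Rightarrow> nat \<Rightarrow> 'n::finite polyC \<Rightarrow> 'n polyC" where
  "ortho_proj M n p =
     (THE q. q \<in> ortho_polys M n \<and> (\<forall>r\<in>ortho_polys M n. inner_mu M r (p - q) = 0))"

text \<open>On each polynomial only finitely many terms of the series defining \<open>a\<^sup>+\<^sub>v\<close> are nonzero.\<close>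

definition a_plus :: "(real ^ 'n) measure \<Rightarrow> complex ^ 'n \<Rightarrow> 'n::finite polyC \<Rightarrow> 'n polyC" where
  "a_plus M v p = Sum_any (\<lambda>n. ortho_proj M (Suc n) (Xvec v * ortho_proj M n p))"

definition a_zero :: "(real ^ 'n) measure \<Rightarrow> complex ^ 'n \<Rightarrow> nat \<Rightarrow> 'n::finite polyC \<Rightarrow> 'n polyC" where
  "a_zero M v n p = ortho_proj M n (Xvec v * ortho_proj M n p)"

text \<open>A tensor of order \<open>n\<close> over \<open>\<complex>\<^sup>d\<close> is given by its coordinates in the basis
  \<open>e\<^bsub>j1\<^esub> \<otimes> \<dots> \<otimes> e\<^bsub>jn\<^esub>\<close>, i.e. by a function on the lists of length \<open>n\<close>, extended by \<open>0\<close> to the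
  other lists.\<close>

type_synonym 'n tensor = "'n list \<Rightarrow> complex"

definition sym_tensors :: "nat \<Rightarrow> 'n tensor set" where
  "sym_tensors n = {t. (\<forall>js. length js \<noteq> n \<longrightarrow> t js = 0) \<and>
     (\<forall>js \<sigma>. length js = n \<longrightarrow> \<sigma> permutes {..<n} \<longrightarrow> t (permute_list \<sigma> js) = t js)}"

definition tensor_of :: "(complex ^ 'n) list \<Rightarrow> 'n::finite tensor" where
  "tensor_of vs js =
     (if length js = length vs then \<Prod>k<length vs. (vs ! k) $ (js ! k) else 0)"

definition sym_tensor_of :: "(complex ^ 'n) list \<Rightarrow> 'n::finite tensor" where
  "sym_tensor_of vs js =
     (\<Sum>\<sigma> | \<sigma> permutes {..<length vs}. tensor_of (permute_list \<sigma> vs) js) / fact (length vs)"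

definition tensor_inner :: "nat \<Rightarrow> 'n::finite tensor \<Rightarrow> 'n tensor \<Rightarrow> complex" where
  "tensor_inner n s t = (\<Sum>js | length js = n. cnj (s js) * t js)"

text \<open>This is the scalar product normalised by \<open>\<langle>u\<^sup>\<otimes>\<^sup>n, v\<^sup>\<otimes>\<^sup>n\<rangle> = \<langle>u, v\<rangle>\<^sup>n\<close>.\<close>

lemma tensor_inner_replicate:
  fixes u v :: "complex ^ 'n::finite"
  shows "tensor_inner n (tensor_of (replicate n u)) (tensor_of (replicate n v))
           = (\<Sum>j\<in>UNIV. cnj (u $ j) * v $ j) ^ n"
proof (induction n)
  case 0
  show ?case by (simp add: tensor_inner_def tensor_of_def)
next
  case (Suc n)
  let ?f = "\<lambda>w (js :: 'n list). tensor_of (replicate n w) js"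
  have step: "tensor_of (replicate (Suc n) w) (j # js) = w $ j * ?f w js"
    if "length js = n" for w :: "complex ^ 'n" and j js
    using that
    by (simp add: tensor_of_def prod.lessThan_Suc_shift del: replicate.simps prod.lessThan_Suc)
  have lists: "{js :: 'n list. length js = Suc n}
      = (\<lambda>(j, js). j # js) ` (UNIV \<times> {js. length js = n})"
    by (auto simp: length_Suc_conv image_iff)
  have "tensor_inner (Suc n) (tensor_of (replicate (Suc n) u)) (tensor_of (replicate (Suc n) v))
      = (\<Sum>(j, js)\<in>UNIV \<times> {js :: 'n list. length js = n}.
           cnj (tensor_of (replicate (Suc n) u) (j # js)) * tensor_of (replicate (Suc n) v) (j # js))"
    unfolding tensor_inner_def lists
    by (subst sum.reindex) (auto simp: inj_on_def case_prod_beta)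
  also have "\<dots> = (\<Sum>(j, js)\<in>UNIV \<times> {js :: 'n list. length js = n}.
           (cnj (u $ j) * v $ j) * (cnj (?f u js) * ?f v js))"
    by (intro sum.cong refl)
      (simp add: case_prod_beta mem_Times_iff step mult_ac del: replicate.simps)
  also have "\<dots> = (\<Sum>j\<in>UNIV. cnj (u $ j) * v $ j) * tensor_inner n (?f u) (?f v)"
    by (simp add: tensor_inner_def sum_product sum.cartesian_product)
  finally show ?case using Suc by simp
qed

text \<open>The isomorphism \<open>U\<^sub>n\<close>, with the product \<open>a\<^sup>+ \<dots> a\<^sup>+ 1\<close> written as a right fold over the list
  \<open>[v\<^sub>n, \<dots>, v\<^sub>1]\<close>. Extensionality only fixes the values outside the symmetric tensors.\<close>

definition fock_iso :: "(real ^ 'n) measure \<Rightarrow> nat \<Rightarrow> 'n::finite tensor \<Rightarrow> 'n polyC" where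
  "fock_iso M n = (THE U. U \<in> extensional (sym_tensors n)
     \<and> bij_betw U (sym_tensors n) (ortho_polys M n)
     \<and> (\<forall>s\<in>sym_tensors n. \<forall>t\<in>sym_tensors n. U (\<lambda>js. s js + t js) = U s + U t)
     \<and> (\<forall>c. \<forall>t\<in>sym_tensors n. U (\<lambda>js. c * t js) = Const c * U t)
     \<and> (\<forall>vs. length vs = n \<longrightarrow> U (sym_tensor_of vs) = foldr (a_plus M) vs 1))"

definition jacobi_Omega :: "(real ^ 'n) measure \<Rightarrow> nat \<Rightarrow> 'n::finite tensor \<Rightarrow> 'n tensor" where
  "jacobi_Omega M n \<eta> = (THE \<zeta>. \<zeta> \<in> sym_tensors n \<and>
     (\<forall>\<xi>\<in>sym_tensors n. tensor_inner n \<xi> \<zeta> = inner_mu M (fock_iso M n \<xi>) (fock_iso M n \<eta>)))"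

definition jacobi_alpha ::
    "(real ^ 'n) measure \<Rightarrow> complex ^ 'n \<Rightarrow> nat \<Rightarrow> 'n::finite tensor \<Rightarrow> 'n tensor" where
  "jacobi_alpha M v n \<xi> =
     inv_into (sym_tensors n) (fock_iso M n) (a_zero M v n (fock_iso M n \<xi>))"

definition cl :: "'n list \<Rightarrow> 'n list set" where
  "cl js = {ks. length ks = length js \<and> (\<forall>l. count_list ks l = count_list js l)}"

definition basis_tensor :: "'n::finite list set \<Rightarrow> 'n tensor" where
  "basis_tensor c = (THE t. \<exists>js\<in>c. t = sym_tensor_of (map (\<lambda>j. axis j 1) js))"

lemma sym_tensor_of_permute:
  fixes vs :: "(complex ^ 'n::finite) list"
  assumes \<tau>: "\<tau> permutes {..<length vs}"
  shows "sym_tensor_of (permute_list \<tau> vs) = sym_tensor_of vs"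
proof
  fix js
  let ?P = "{\<sigma>. \<sigma> permutes {..<length vs}}"
  have "(\<Sum>\<sigma>\<in>?P. tensor_of (permute_list \<sigma> (permute_list \<tau> vs)) js)
      = (\<Sum>\<sigma>\<in>?P. tensor_of (permute_list (\<tau> \<circ> \<sigma>) vs) js)"
    by (intro sum.cong refl) (simp add: permute_list_compose)
  also have "\<dots> = (\<Sum>\<sigma>\<in>?P. tensor_of (permute_list \<sigma> vs) js)"
    by (rule setum_permutations_compose_left [OF \<tau>, symmetric])
  finally show "sym_tensor_of (permute_list \<tau> vs) js = sym_tensor_of vs js"
    by (simp add: sym_tensor_of_def)
qed

text \<open>The description in \<^const>\<open>basis_tensor\<close> does not depend on the representative.\<close>

lemma basis_tensor_cl: "basis_tensor (cl js) = sym_tensor_of (map (\<lambda>j. axis j 1) js)"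
  for js :: "'n::finite list"
proof -
  have eq: "sym_tensor_of (map (\<lambda>j. axis j 1 :: complex ^ 'n) ks)
              = sym_tensor_of (map (\<lambda>j. axis j 1) js)"
    if "ks \<in> cl js" for ks
  proof -
    have "mset js = mset ks"
      using that by (intro multiset_eqI) (simp add: cl_def count_mset)
    then obtain \<tau> where "\<tau> permutes {..<length js}" "permute_list \<tau> js = ks"
      by (metis mset_eq_permutation)
    then show ?thesis
      using sym_tensor_of_permute [of \<tau> "map (\<lambda>j. axis j 1) js"]
      by (simp add: permute_list_map)
  qed
  have "js \<in> cl js" by (simp add: cl_def)
  then show ?thesis
    unfolding basis_tensor_def using eq by (intro the_equality) blast+
qed

definition Omega_coeff ::
    "(real ^ 'n) measure \<Rightarrow> nat \<Rightarrow> 'n::finite list set \<Rightarrow> 'n list set \<Rightarrow> complex" where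
  "Omega_coeff M n c c' =
     tensor_inner n (basis_tensor c) (jacobi_Omega M n (basis_tensor c'))"

definition laguerre_weight :: "('n \<Rightarrow> real) \<Rightarrow> real ^ 'n::finite \<Rightarrow> real" where
  "laguerre_weight \<alpha> x = (\<Prod>j\<in>UNIV. x $ j powr \<alpha> j * exp (- (x $ j)))"

definition laguerre_measure :: "('n \<Rightarrow> real) \<Rightarrow> (real ^ 'n::finite) measure" where
  "laguerre_measure \<alpha> =
     density lborel (\<lambda>x. ennreal (indicator {x. \<forall>j. 0 \<le> x $ j} x * laguerre_weight \<alpha> x))"

end

theory Submission
  imports Defs "HOL-Computational_Algebra.Polynomial"
begin

text \<open>For each coordinate \<open>j\<close> let \<open>q\<^sub>j\<^sub>,\<^sub>k\<close> be the monic Laguerre polynomial of degree \<open>k\<close> with parameter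
\<open>\<alpha>\<^sub>j\<close>. The products \<open>L\<^sub>m = \<Prod>\<^sub>j q\<^sub>j\<^sub>,\<^sub>m\<^sub>j(X\<^sub>j)\<close>, indexed by exponent vectors \<open>m\<close>, are orthogonal for the
Laguerre measure, which is a product measure, and those with \<open>|m| = n\<close> form a basis of the space of
orthogonal polynomials of degree \<open>n\<close>. In this basis every operator of the theorem is explicit, because
the one-variable three-term recurrence reads
\<open>X\<^sub>j L\<^sub>m = L\<^bsub>m + e\<^sub>j\<^esub> + (2 m\<^sub>j + \<alpha>\<^sub>j + 1) L\<^sub>m + m\<^sub>j (m\<^sub>j + \<alpha>\<^sub>j) L\<^bsub>m - e\<^sub>j\<^esub>\<close>.
The three terms have total degree \<open>|m| + 1\<close>, \<open>|m|\<close> and \<open>|m| - 1\<close>. Hence \<open>a\<^sup>+\<close> for the direction \<open>e\<^sub>j\<close>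
maps \<open>L\<^sub>m\<close> to \<open>L\<^bsub>m + e\<^sub>j\<^esub>\<close>, and \<open>a\<^sup>0\<close> for the same direction multiplies \<open>L\<^sub>m\<close> by \<open>2 m\<^sub>j + \<alpha>\<^sub>j + 1\<close>.

Starting from \<open>1 = L\<^sub>0\<close>, the creation operators along a word \<open>j\<^sub>1 \<dots> j\<^sub>n\<close> of basis vectors therefore produce
\<open>L\<^sub>m\<close> with \<open>m\<close> the letter counts of the word. So the isomorphism \<open>U\<^sub>n\<close> sends the symmetric basis tensor of the
word to \<open>L\<^sub>m\<close>, and the two claims become statements about \<open>L\<^sub>m\<close>: the eigenvalue of \<open>a\<^sup>0\<close> just found, and the
squared norm \<open>\<Prod>\<^sub>j m\<^sub>j! \<Gamma>(m\<^sub>j + \<alpha>\<^sub>j + 1)\<close> together with orthogonality.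

The argument after the recurrence is the same for every measure that has such an orthogonal basis. It is carried
out in the locale \<open>orthogonal_recurrence_basis\<close>, whose results are \<open>jacobi_alpha_basis_tensor\<close> and
\<open>Omega_coeff_eq\<close>. Most of the work there is to show that the definite descriptions behind the projections, \<open>U\<^sub>n\<close>
and \<open>\<Omega>\<^sub>n\<close> denote the expected objects. The Laguerre input is \<open>Xvar_laguerre_basis\<close> and
\<open>inner_laguerre_basis\<close>.\<close>

section \<open>Monic Laguerre polynomials in one variable\<close>

definition laguerre_density :: "real \<Rightarrow> real \<Rightarrow> real" where
  "laguerre_density a t = indicator {0..} t * (t powr a * exp (- t))"

lemma laguerre_density_measurable [measurable]: "laguerre_density a \<in> borel_measurable borel"
  unfolding laguerre_density_def by measurable

text \<open>Euler's integral for \<open>\<Gamma>\<close>. The law of exponents that merges \<open>t ^ i\<close> with \<open>t powr a\<close> needs \<open>t > 0\<close>, so the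
point \<open>0\<close> is discarded as a null set.\<close>

lemma has_bochner_integral_Gamma_moment:
  assumes "a > -1"
  shows "has_bochner_integral lborel (\<lambda>t. t ^ i * laguerre_density a t) (Gamma (real i + a + 1))"
proof (rule has_bochner_integral_nn_integral)
  let ?f = "\<lambda>t. t ^ i * laguerre_density a t"
  have pos: "0 < real i + a + 1" using assms by linarith
  have "((\<lambda>t. if t \<in> {0..} then t powr (real i + a + 1 - 1) / exp t else 0)
      has_integral Gamma (real i + a + 1)) UNIV"
    using Gamma_integral_real [OF pos] by (simp only: has_integral_restrict_UNIV)
  then have "(?f has_integral Gamma (real i + a + 1)) UNIV"
  proof (rule has_integral_spike [of "{0}", rotated 2])
    fix t :: real assume "t \<in> UNIV - {0}"
    then show "?f t = (if t \<in> {0..} then t powr (real i + a + 1 - 1) / exp t else 0)"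
      by (auto simp: laguerre_density_def exp_minus powr_add powr_realpow field_simps)
  qed simp
  moreover have nn: "0 \<le> ?f t" for t by (simp add: laguerre_density_def indicator_def)
  ultimately show "(\<integral>\<^sup>+ t. ennreal (?f t) \<partial>lborel) = ennreal (Gamma (real i + a + 1))"
    by (intro nn_integral_has_integral_lborel) auto
  show "AE t in lborel. 0 \<le> ?f t" using nn by simp
  show "0 \<le> Gamma (real i + a + 1)" using pos by (simp add: Gamma_real_nonneg)
qed simp

definition laguerre_functional :: "real \<Rightarrow> real poly \<Rightarrow> real" where
  "laguerre_functional a p = (\<integral>t. poly p t * laguerre_density a t \<partial>lborel)"

lemma integrable_poly_laguerre_density:
  assumes "a > -1"
  shows "integrable lborel (\<lambda>t. poly p t * laguerre_density a t)"
proof -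
  have "integrable lborel (\<lambda>t. \<Sum>i\<le>degree p. coeff p i * (t ^ i * laguerre_density a t))"
    using has_bochner_integral_Gamma_moment [OF assms]
    by (intro Bochner_Integration.integrable_sum integrable_mult_right)
      (auto simp: has_bochner_integral_iff)
  then show ?thesis
    by (simp add: poly_altdef sum_distrib_right mult.assoc)
qed

lemma laguerre_functional_diff:
  "a > -1 \<Longrightarrow> laguerre_functional a (p - q) = laguerre_functional a p - laguerre_functional a q"
  by (simp add: laguerre_functional_def left_diff_distrib integrable_poly_laguerre_density)

lemma laguerre_functional_smult:
  "a > -1 \<Longrightarrow> laguerre_functional a (smult c p) = c * laguerre_functional a p"
  by (simp add: laguerre_functional_def mult.assoc)

lemma laguerre_functional_monom:
  "a > -1 \<Longrightarrow> laguerre_functional a (monom 1 i) = Gamma (real i + a + 1)"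
  using has_bochner_integral_Gamma_moment [of a i]
  by (simp add: laguerre_functional_def poly_monom has_bochner_integral_iff)

text \<open>These are the classical Laguerre polynomials rescaled to be monic, \<open>(-1)\<^sup>k k! L\<^sub>k\<^sup>(\<^sup>a\<^sup>)\<close>. Taking their three-term
recurrence as the definition makes both the multiplication by \<open>X\<close> and the orthogonality proof inductions on \<open>k\<close>.\<close>

fun laguerre :: "real \<Rightarrow> nat \<Rightarrow> real poly" where
  "laguerre a 0 = 1"
| "laguerre a (Suc 0) = [:- (a + 1), 1:]"
| "laguerre a (Suc (Suc k)) = [:- (2 * real k + 3 + a), 1:] * laguerre a (Suc k)
     - smult (real (Suc k) * (real (Suc k) + a)) (laguerre a k)"

text \<open>For \<open>k = 0\<close> the last term has coefficient \<open>0\<close>, so the truncated index \<open>k - 1 = 0\<close> does no harm.\<close>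

lemma laguerre_recurrence:
  "monom 1 1 * laguerre a k
     = laguerre a (Suc k) + smult (2 * real k + a + 1) (laguerre a k)
       + smult (real k * (real k + a)) (laguerre a (k - 1))"
proof (cases k)
  case 0
  then show ?thesis by (simp add: monom_Suc algebra_simps)
next
  case (Suc l)
  show ?thesis
    by (rule poly_eqI)
       (simp add: Suc monom_Suc algebra_simps coeff_pCons split: nat.splits)
qed

lemma monom_mult_laguerre_Suc_Suc:
  "monom 1 i * laguerre a (Suc (Suc k))
     = monom 1 (Suc i) * laguerre a (Suc k)
       - smult (2 * real k + 3 + a) (monom 1 i * laguerre a (Suc k))
       - smult (real (Suc k) * (real (Suc k) + a)) (monom 1 i * laguerre a k)"
  by (simp add: monom_Suc algebra_simps flip: smult_add_left)

lemma Suc_times_binomial_Suc: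
  "(real i - real k) * real (i choose k) = real (Suc k) * real (i choose Suc k)"
proof -
  have "real (Suc k) * real (Suc i choose Suc k) = real (Suc i) * real (i choose k)"
    by (metis Suc_times_binomial of_nat_mult)
  then show ?thesis by (simp add: algebra_simps)
qed

text \<open>Pairing \<open>t\<^sup>i\<close> with the \<open>k\<close>-th polynomial multiplies the moment \<open>\<Gamma>(i + a + 1)\<close> by the falling factorial
\<open>i (i - 1) \<dots> (i - k + 1)\<close>, here written \<open>k! (i choose k)\<close>. This closed form passes through the recurrence by
\<open>\<Gamma>(x + 1) = x \<Gamma>(x)\<close>, and it contains the orthogonality, since it vanishes for \<open>i < k\<close>.\<close>

lemma laguerre_functional_monom_laguerre:
  assumes "a > -1"
  shows "laguerre_functional a (monom 1 i * laguerre a k)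
           = Gamma (real i + a + 1) * (fact k * real (i choose k))"
\<comment> \<open>Two-step induction on \<open>k\<close>, taken from the recursion of \<open>laguerre\<close> with a predicate that ignores its parameter.\<close>
proof (induction k arbitrary: i rule: laguerre.induct [of "\<lambda>_. P" for P, case_names 0 1 step])
  case 0
  show ?case using assms by (simp add: laguerre_functional_monom)
next
  case (1 a')
  have "monom 1 i * laguerre a (Suc 0) = monom 1 (Suc i) - smult (a + 1) (monom 1 i)"
    by (simp add: monom_Suc algebra_simps flip: smult_add_left)
  then have "laguerre_functional a (monom 1 i * laguerre a (Suc 0))
      = Gamma (real (Suc i) + a + 1) - (a + 1) * Gamma (real i + a + 1)"
    using assms
    by (simp only: laguerre_functional_diff laguerre_functional_smult laguerre_functional_monom)
  moreover have "Gamma (real (Suc i) + a + 1) = (real i + a + 1) * Gamma (real i + a + 1)"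
    using Gamma_plus1 [of "real i + a + 1"] assms
    by (auto simp: nonpos_Ints_def add_ac)
  ultimately show ?case by (simp add: algebra_simps)
next
  case (step a' k)
  let ?\<phi> = "laguerre_functional a" and ?G = "Gamma (real i + a + 1)"
  have "monom 1 i * laguerre a (Suc (Suc k))
      = monom 1 (Suc i) * laguerre a (Suc k)
        - smult (2 * real k + 3 + a) (monom 1 i * laguerre a (Suc k))
        - smult (real (Suc k) * (real (Suc k) + a)) (monom 1 i * laguerre a k)"
    by (rule monom_mult_laguerre_Suc_Suc)
  then have eq: "?\<phi> (monom 1 i * laguerre a (Suc (Suc k)))
      = Gamma (real (Suc i) + a + 1) * (fact (Suc k) * real (Suc i choose Suc k))
        - (2 * real k + 3 + a) * (?G * (fact (Suc k) * real (i choose Suc k)))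
        - (real (Suc k) * (real (Suc k) + a)) * (?G * (fact k * real (i choose k)))"
    using assms step.IH by (simp add: laguerre_functional_diff laguerre_functional_smult
        del: laguerre.simps of_nat_Suc fact_Suc binomial_Suc_Suc)
  have G: "Gamma (real (Suc i) + a + 1) = (real i + a + 1) * ?G"
    using Gamma_plus1 [of "real i + a + 1"] assms
    by (auto simp: nonpos_Ints_def add_ac)
  have "fact (Suc k) * real (Suc i choose Suc k) = fact k * real (Suc k * (Suc i choose Suc k))"
    by (simp add: algebra_simps del: binomial_Suc_Suc)
  then have e0: "fact (Suc k) * real (Suc i choose Suc k) = fact k * (real (Suc i) * real (i choose k))"
    by (simp only: Suc_times_binomial of_nat_mult)
  have e1: "fact (Suc k) * real (i choose Suc k) = fact k * ((real i - real k) * real (i choose k))" for k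
    by (simp add: Suc_times_binomial_Suc del: binomial_Suc_Suc)
  have e2: "fact (Suc (Suc k)) * real (i choose Suc (Suc k))
      = (real i - real (Suc k)) * (fact k * ((real i - real k) * real (i choose k)))"
    unfolding e1 [of "Suc k"] e1 [of k, symmetric] by (simp only: ac_simps)
  show ?case
    unfolding eq G e0 e1 [of k] e2 by (simp add: algebra_simps)
qed

text \<open>The \<open>j\<close>-th polynomial is \<open>t\<^sup>j\<close> plus lower powers, and lower powers pair to \<open>0\<close> with the \<open>k\<close>-th one if
\<open>j \<le> k\<close>. To avoid handling coefficients, the induction on \<open>j\<close> runs over the products
\<open>t\<^sup>i q\<^sub>j\<close> with \<open>i + j \<le> k\<close>: the recurrence writes \<open>t\<^sup>i q\<^bsub>j+2\<^esub>\<close> as \<open>t\<^bsup>i+1\<^esup> q\<^bsub>j+1\<^esub>\<close>, which has the same \<open>i + j\<close>,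
plus terms with smaller \<open>i + j\<close>.\<close>

lemma laguerre_orthogonal:
  assumes a: "a > -1"
  shows "laguerre_functional a (laguerre a j * laguerre a k)
           = (if j = k then fact k * Gamma (real k + a + 1) else 0)"
proof -
  have *: "laguerre_functional a (monom 1 i * laguerre a j * laguerre a k)
      = (if i + j = k then fact k * Gamma (real k + a + 1) else 0)" if "i + j \<le> k" for i j k
    using that
  proof (induction j arbitrary: i rule: laguerre.induct [of "\<lambda>_. P" for P, case_names 0 1 step])
    case 0
    then show ?case using a by (simp add: laguerre_functional_monom_laguerre)
  next
    case (1 a')
    have "monom 1 i * laguerre a (Suc 0) * laguerre a k
       = monom 1 (Suc i) * laguerre a k - smult (a + 1) (monom 1 i * laguerre a k)"
      by (simp add: monom_Suc algebra_simps flip: smult_add_left)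
    then show ?case using 1 a
      by (auto simp add: laguerre_functional_monom_laguerre laguerre_functional_diff
        laguerre_functional_smult binomial_eq_0 simp del: laguerre.simps binomial_Suc_Suc)
  next
    case (step a' j)
    have "monom 1 i * laguerre a (Suc (Suc j)) * laguerre a k
      = monom 1 (Suc i) * laguerre a (Suc j) * laguerre a k
        - smult (2 * real j + 3 + a) (monom 1 i * laguerre a (Suc j) * laguerre a k)
        - smult (real (Suc j) * (real (Suc j) + a)) (monom 1 i * laguerre a j * laguerre a k)"
      unfolding monom_mult_laguerre_Suc_Suc by (simp add: left_diff_distrib)
    then show ?case using a step.prems step.IH(1)[of "Suc i"] step.IH(1)[of i] step.IH(2)[of i]
      by (auto simp: laguerre_functional_diff laguerre_functional_smult
        simp del: laguerre.simps of_nat_Suc)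
  qed
  show ?thesis
  proof (cases "j \<le> k")
    case True then show ?thesis using *[of 0 j k] by simp
  next
    case False then show ?thesis using *[of 0 k j] by (simp add: mult.commute)
  qed
qed

section \<open>Integration against the Laguerre weight on the orthant\<close>

text \<open>Fubini for products of one-variable functions. Lebesgue measure on a Euclidean space is the image of a product
over the set of basis vectors, so the index \<open>j\<close> is transported along \<open>j \<mapsto> axis j 1\<close>.\<close>

lemma has_bochner_integral_lborel_cart_prod:
  fixes f :: "'n::finite \<Rightarrow> real \<Rightarrow> real"
  assumes int: "\<And>j. integrable lborel (f j)"
  shows "has_bochner_integral lborel (\<lambda>x::real^'n. \<Prod>j\<in>UNIV. f j (x $ j))
       (\<Prod>j\<in>UNIV. \<integral>t. f j t \<partial>lborel)"
proof -
  interpret product_sigma_finite "\<lambda>b::real^'n. lborel :: real measure" ..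
  let ?a = "\<lambda>j. axis j 1 :: real^'n"
  let ?S = "\<lambda>y. \<Sum>b\<in>Basis. y b *\<^sub>R b :: real^'n"
  let ?g = "\<lambda>b. f (inv ?a b)"
  have inj: "inj ?a" by (auto simp: inj_def axis_eq_axis)
  have Basis: "(Basis :: (real^'n) set) = range ?a" by (auto simp: Basis_vec_def)
  have [measurable]: "f j \<in> borel_measurable borel" for j
    using int [of j] by (simp add: integrable_iff_bounded)
  have coord: "?S y $ j = y (?a j)" for y j
    by (simp only: cart_eq_inner_axis [of "?S y"]) (rule inner_sum_left_Basis, simp)
  have prod: "(\<Prod>j\<in>UNIV. f j (?S y $ j)) = (\<Prod>b\<in>Basis. ?g b (y b))" for y
    by (simp only: coord) (simp add: Basis prod.reindex inj inv_f_f [OF inj])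
  have "integrable (\<Pi>\<^sub>M b\<in>Basis. lborel) (\<lambda>y. \<Prod>b\<in>Basis. ?g b (y b))"
    by (intro product_integrable_prod int) simp
  moreover have "(\<integral>y. (\<Prod>b\<in>Basis. ?g b (y b)) \<partial>(\<Pi>\<^sub>M b\<in>Basis. lborel))
      = (\<Prod>b\<in>Basis. \<integral>t. ?g b t \<partial>lborel)"
    by (intro product_integral_prod int) simp
  moreover have "\<dots> = (\<Prod>j\<in>UNIV. \<integral>t. f j t \<partial>lborel)"
    by (simp add: Basis prod.reindex inj inv_f_f [OF inj])
  ultimately show ?thesis
    by (subst lborel_eq)
      (simp add: has_bochner_integral_iff integrable_distr_eq integral_distr prod del: sum_component)
qed

lemma has_bochner_integral_laguerre_measure:
  fixes \<alpha> :: "'n::finite \<Rightarrow> real"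
  assumes \<alpha>: "\<And>j. \<alpha> j > -1"
  shows "has_bochner_integral (laguerre_measure \<alpha>)
           (\<lambda>x. complex_of_real (\<Prod>j\<in>UNIV. poly (p j) (x $ j)))
           (complex_of_real (\<Prod>j\<in>UNIV. laguerre_functional (\<alpha> j) (p j)))"
proof (rule has_bochner_integral_bounded_linear [OF bounded_linear_of_real])
  have weight: "indicator {x. \<forall>j. 0 \<le> x $ j} x * laguerre_weight \<alpha> x
      = (\<Prod>j\<in>UNIV. laguerre_density (\<alpha> j) (x $ j))" for x :: "real^'n"
    by (auto simp: laguerre_weight_def laguerre_density_def indicator_def)
  have nn: "0 \<le> laguerre_density a t" for a t
    by (simp add: laguerre_density_def)
  have [measurable]: "(\<lambda>x::real^'n. poly (p j) (x $ j)) \<in> borel_measurable borel" for j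
    by (intro borel_measurable_continuous_onI continuous_intros)
  show "has_bochner_integral (laguerre_measure \<alpha>) (\<lambda>x. \<Prod>j\<in>UNIV. poly (p j) (x $ j))
           (\<Prod>j\<in>UNIV. laguerre_functional (\<alpha> j) (p j))"
    unfolding laguerre_measure_def weight
  proof (rule has_bochner_integral_density)
    have "has_bochner_integral lborel
        (\<lambda>x::real^'n. \<Prod>j\<in>UNIV. poly (p j) (x $ j) * laguerre_density (\<alpha> j) (x $ j))
        (\<Prod>j\<in>UNIV. \<integral>t. poly (p j) t * laguerre_density (\<alpha> j) t \<partial>lborel)"
      by (intro has_bochner_integral_lborel_cart_prod integrable_poly_laguerre_density \<alpha>)
    then show "has_bochner_integral lborel
        (\<lambda>x::real^'n. (\<Prod>j\<in>UNIV. laguerre_density (\<alpha> j) (x $ j)) *\<^sub>R (\<Prod>j\<in>UNIV. poly (p j) (x $ j)))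
        (\<Prod>j\<in>UNIV. laguerre_functional (\<alpha> j) (p j))"
      by (simp add: laguerre_functional_def prod.distrib mult.commute)
  qed (auto intro!: prod_nonneg nn)
qed

section \<open>Polynomials in several variables: evaluation, substitution, degree\<close>

lemma eval_poly_superset:
  assumes "finite A" "Poly_Mapping.keys p \<subseteq> A"
  shows "eval_poly p x = (\<Sum>m\<in>A.
     Poly_Mapping.lookup p m * (\<Prod>j\<in>UNIV. complex_of_real (x $ j) ^ Poly_Mapping.lookup m j))"
  unfolding eval_poly_def using assms
  by (intro sum.mono_neutral_left) (auto simp: in_keys_iff)

lemma eval_poly_zero [simp]: "eval_poly 0 x = 0"
  by (simp add: eval_poly_def)

lemma eval_poly_add [simp]: "eval_poly (p + q) x = eval_poly p x + eval_poly q x"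
proof -
  let ?A = "Poly_Mapping.keys p \<union> Poly_Mapping.keys q"
  show ?thesis
    using Poly_Mapping.keys_add [of p q]
    by (simp add: eval_poly_superset [of ?A] lookup_add distrib_right sum.distrib)
qed

lemma eval_poly_single:
  "eval_poly (Poly_Mapping.single m c) x
     = c * (\<Prod>j\<in>UNIV. complex_of_real (x $ j) ^ Poly_Mapping.lookup m j)"
  by (simp add: eval_poly_superset [of "{m}"])

lemma eval_poly_sum [simp]: "eval_poly (sum f A) x = (\<Sum>i\<in>A. eval_poly (f i) x)"
  by (induction A rule: infinite_finite_induct) auto

lemma poly_mapping_sum_singles:
  "(\<Sum>m\<in>Poly_Mapping.keys p. Poly_Mapping.single m (Poly_Mapping.lookup p m)) = p"
  by (rule poly_mapping_eqI)
     (simp add: lookup_sum lookup_single when_def in_keys_iff)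

text \<open>Both sides are bilinear, so single monomials suffice, and for these exponents add.\<close>

lemma eval_poly_mult [simp]: "eval_poly (p * q) x = eval_poly p x * eval_poly q x"
proof -
  let ?s = "\<lambda>p m. Poly_Mapping.single m (Poly_Mapping.lookup p m)"
  have *: "eval_poly (?s p m * ?s q l) x = eval_poly (?s p m) x * eval_poly (?s q l) x" for m l
    by (simp add: mult_single eval_poly_single lookup_add power_add prod.distrib mult_ac)
  have "eval_poly ((\<Sum>m\<in>Poly_Mapping.keys p. ?s p m) * (\<Sum>m\<in>Poly_Mapping.keys q. ?s q m)) x
      = eval_poly (\<Sum>m\<in>Poly_Mapping.keys p. ?s p m) x * eval_poly (\<Sum>m\<in>Poly_Mapping.keys q. ?s q m) x"
    unfolding sum_product eval_poly_sum * ..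
  then show ?thesis by (simp only: poly_mapping_sum_singles)
qed

lemma eval_poly_Const [simp]: "eval_poly (Const c) x = c"
  by (simp add: Const_def eval_poly_single)

lemma Const_one [simp]: "Const 1 = 1"
  by (simp add: Const_def)

lemma eval_poly_one [simp]: "eval_poly 1 x = 1"
  by (simp flip: Const_one)

lemma eval_poly_Xvar [simp]: "eval_poly (Xvar j) x = complex_of_real (x $ j)"
proof -
  have "(\<Prod>i\<in>UNIV. complex_of_real (x $ i) ^ Poly_Mapping.lookup (Poly_Mapping.single j 1) i)
      = (\<Prod>i\<in>UNIV. if i = j then complex_of_real (x $ i) else 1)"
    by (intro prod.cong) (auto simp: lookup_single)
  then show ?thesis by (simp add: Xvar_def eval_poly_single)
qed

lemma eval_poly_prod [simp]: "eval_poly (prod f A) x = (\<Prod>i\<in>A. eval_poly (f i) x)"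
  by (induction A rule: infinite_finite_induct) auto

text \<open>The one-variable polynomial with its variable replaced by \<open>X\<^sub>j\<close>. It carries the recurrence and the values of
\<open>laguerre\<close> over to several variables without a second definition by recursion.\<close>

definition poly_at_Xvar :: "'n \<Rightarrow> real poly \<Rightarrow> 'n::finite polyC" where
  "poly_at_Xvar j p = poly (map_poly (\<lambda>c. Const (complex_of_real c)) p) (Xvar j)"

lemma poly_at_Xvar_0 [simp]: "poly_at_Xvar j 0 = 0"
  by (simp add: poly_at_Xvar_def)

lemma poly_at_Xvar_pCons [simp]: "poly_at_Xvar j (pCons c p) = Const (complex_of_real c) + Xvar j * poly_at_Xvar j p"
  by (simp add: poly_at_Xvar_def map_poly_pCons Const_def)

lemma poly_at_Xvar_1 [simp]: "poly_at_Xvar j 1 = 1"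
  by (simp add: one_pCons)

lemma poly_at_Xvar_add: "poly_at_Xvar j (p + q) = poly_at_Xvar j p + poly_at_Xvar j q"
proof (induction p q rule: poly_induct2)
  case (pCons a p b q)
  then show ?case by (simp add: Const_def single_add algebra_simps)
qed simp

lemma poly_at_Xvar_smult: "poly_at_Xvar j (smult c p) = Const (complex_of_real c) * poly_at_Xvar j p"
  by (induction p) (simp_all add: Const_def mult_single algebra_simps)

lemma poly_at_Xvar_monom_mult: "poly_at_Xvar j (monom 1 1 * p) = Xvar j * poly_at_Xvar j p"
  by (simp add: monom_Suc Const_def)

lemma eval_poly_poly_at_Xvar [simp]: "eval_poly (poly_at_Xvar j p) x = complex_of_real (poly p (x $ j))"
  by (induction p) simp_all

text \<open>This makes \<open>inner_mu\<close> sesquilinear on all polynomials; expanding both factors reduces it to the integrability of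
monomials.\<close>

lemma integrable_laguerre_measure_eval_poly:
  fixes \<alpha> :: "'n::finite \<Rightarrow> real"
  assumes \<alpha>: "\<And>j. \<alpha> j > -1"
  shows "integrable (laguerre_measure \<alpha>) (\<lambda>x. cnj (eval_poly p x) * eval_poly q x)"
proof -
  let ?c = "\<lambda>m l. cnj (Poly_Mapping.lookup p m) * Poly_Mapping.lookup q l"
  let ?k = "\<lambda>m l j. Poly_Mapping.lookup m j + Poly_Mapping.lookup l j"
  have "integrable (laguerre_measure \<alpha>)
      (\<lambda>x. complex_of_real (\<Prod>j\<in>UNIV. poly (monom 1 (?k m l j)) (x $ j)))" for m l
    using has_bochner_integral_laguerre_measure [where \<alpha> = \<alpha> and p = "\<lambda>j. monom 1 (?k m l j)", OF \<alpha>]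
    by (simp only: has_bochner_integral_iff)
  then have "integrable (laguerre_measure \<alpha>)
      (\<lambda>x. \<Sum>m\<in>Poly_Mapping.keys p. \<Sum>l\<in>Poly_Mapping.keys q. ?c m l *
        complex_of_real (\<Prod>j\<in>UNIV. poly (monom 1 (?k m l j)) (x $ j)))"
    by (intro Bochner_Integration.integrable_sum integrable_mult_right)
  also have "(\<lambda>x. \<Sum>m\<in>Poly_Mapping.keys p. \<Sum>l\<in>Poly_Mapping.keys q. ?c m l *
        complex_of_real (\<Prod>j\<in>UNIV. poly (monom 1 (?k m l j)) (x $ j)))
      = (\<lambda>x. cnj (eval_poly p x) * eval_poly q x)"
    unfolding eval_poly_def cnj_sum sum_product
    by (intro ext sum.cong refl) (simp add: poly_monom power_add prod.distrib mult_ac)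
  finally show ?thesis .
qed

lemma Const_mult: "Const (a * b) = Const a * Const b"
  by (simp add: Const_def mult_single)

lemma Const_add: "Const (a + b) = Const a + Const b"
  by (simp add: Const_def single_add)

lemma Const_zero [simp]: "Const 0 = 0"
  by (simp add: Const_def)

lemma Const_of_nat: "Const (of_nat k) = of_nat k"
  by (simp add: Const_def)

lemma Const_sum: "Const (sum f A) = (\<Sum>i\<in>A. Const (f i))"
  by (induction A rule: infinite_finite_induct) (auto simp: Const_add)

lemma polys_upto_mono: "p \<in> polys_upto a \<Longrightarrow> a \<le> b \<Longrightarrow> p \<in> polys_upto b"
  by (force simp: polys_upto_def)

lemma polys_upto_zero [simp]: "0 \<in> polys_upto k"
  by (simp add: polys_upto_def)

lemma polys_upto_neg:
  assumes "k < 0" "p \<in> polys_upto k"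
  shows "p = 0"
proof -
  have "m \<notin> Poly_Mapping.keys p" for m
    using assms of_nat_0_le_iff [of "\<Sum>j\<in>UNIV. Poly_Mapping.lookup m j", where ?'a = int]
    unfolding polys_upto_def by force
  then show ?thesis
    by (metis Poly_Mapping.keys_eq_empty all_not_in_conv)
qed

lemma polys_upto_add: "p \<in> polys_upto k \<Longrightarrow> q \<in> polys_upto k \<Longrightarrow> p + q \<in> polys_upto k"
  using Poly_Mapping.keys_add [of p q] by (fastforce simp: polys_upto_def)

lemma polys_upto_sum: "(\<And>i. i \<in> A \<Longrightarrow> f i \<in> polys_upto k) \<Longrightarrow> sum f A \<in> polys_upto k"
  by (induction A rule: infinite_finite_induct) (auto simp: polys_upto_add)

lemma polys_upto_mult:
  assumes "p \<in> polys_upto a" "q \<in> polys_upto b"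
  shows "p * q \<in> polys_upto (a + b)"
  unfolding polys_upto_def
proof (intro CollectI ballI)
  fix m assume "m \<in> Poly_Mapping.keys (p * q)"
  then obtain k l where "m = k + l" "k \<in> Poly_Mapping.keys p" "l \<in> Poly_Mapping.keys q"
    using Poly_Mapping.keys_mult [of p q] by blast
  then show "int (\<Sum>j\<in>UNIV. Poly_Mapping.lookup m j) \<le> a + b"
    using assms by (fastforce simp: polys_upto_def lookup_add sum.distrib)
qed

lemma Const_in_polys_upto: "Const c \<in> polys_upto 0"
  by (simp add: Const_def polys_upto_def)

lemma Const_mult_polys_upto: "p \<in> polys_upto k \<Longrightarrow> Const c * p \<in> polys_upto k"
  using polys_upto_mult [OF Const_in_polys_upto] by fastforce

lemma Xvar_in_polys_upto: "Xvar j \<in> polys_upto 1"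
proof -
  have "(\<Sum>i\<in>UNIV. Poly_Mapping.lookup (Poly_Mapping.single j (1::nat)) i)
      = (\<Sum>i\<in>UNIV. if i = j then 1 else 0)"
    by (intro sum.cong) (auto simp: lookup_single)
  then show ?thesis by (simp add: Xvar_def polys_upto_def flip: of_nat_sum)
qed

section \<open>Multi-indices and words\<close>

text \<open>Kept as a constant of its own rather than a sum, so that the simplifier does not unfold a function update
below the summation sign.\<close>

definition total :: "('n::finite \<Rightarrow> nat) \<Rightarrow> nat" where
  "total m = sum m UNIV"

lemma total_zero [simp]: "total (\<lambda>_. 0) = 0"
  by (simp add: total_def)

lemma total_eq_0_iff: "total m = 0 \<longleftrightarrow> m = (\<lambda>_. 0)"
  by (auto simp: total_def)

lemma total_fun_upd_Suc: "total (m(j := Suc (m j))) = Suc (total m)"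
  by (simp add: total_def sum.remove [of UNIV j])

lemma total_fun_upd_pred:
  assumes "m j \<noteq> 0"
  shows "Suc (total (m(j := m j - 1))) = total m"
  using assms total_fun_upd_Suc [of "m(j := m j - 1)" j] by simp

lemma total_count_list: "total (count_list js) = length js"
  unfolding total_def by (rule sum_count_set) auto

lemma finite_total_le [simp]: "finite {m :: 'n::finite \<Rightarrow> nat. total m \<le> k}"
proof (rule finite_subset)
  have "m j \<le> total m" for m :: "'n \<Rightarrow> nat" and j
    unfolding total_def by (rule member_le_sum) auto
  then show "{m :: 'n \<Rightarrow> nat. total m \<le> k} \<subseteq> (\<Pi>\<^sub>E j\<in>UNIV. {..k})"
    by (fastforce simp: PiE_UNIV_domain intro: order_trans)
qed (auto intro: finite_PiE)

lemma finite_total_eq [simp]: "finite {m. total m = k}"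
  by (rule finite_subset [OF _ finite_total_le [of k]]) auto

text \<open>Words exhaust the multi-indices, so every basis polynomial lies in the image of \<open>U\<^sub>n\<close>.\<close>

lemma ex_list_with_counts:
  fixes m :: "'n::finite \<Rightarrow> nat"
  shows "\<exists>js. count_list js = m"
proof (induction "total m" arbitrary: m)
  case 0
  then have "count_list [] = m" by (auto simp: total_eq_0_iff fun_eq_iff)
  then show ?case ..
next
  case (Suc k)
  then have "m \<noteq> (\<lambda>_. 0)" by (metis total_eq_0_iff nat.distinct(1))
  then obtain j where j: "m j \<noteq> 0" by auto
  with Suc total_fun_upd_pred [of m j] obtain js where "count_list js = m(j := m j - 1)"
    by (metis Suc_inject)
  with j have "count_list (j # js) = m" by (auto simp: fun_eq_iff)
  then show ?case ..
qed

lemma sum_lists_Suc: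
  "(\<Sum>js | length js = Suc n. f js) = (\<Sum>j\<in>UNIV. \<Sum>js | length js = n. f (j # js))"
  for f :: "'n::finite list \<Rightarrow> 'a::comm_monoid_add"
proof -
  have "{js :: 'n list. length js = Suc n} = (\<lambda>(j, js). j # js) ` (UNIV \<times> {js. length js = n})"
    by (auto simp: length_Suc_conv image_iff)
  then show ?thesis
    by (simp add: sum.cartesian_product sum.reindex inj_on_def case_prod_beta)
qed

lemma tensor_of_Cons: "tensor_of (v # vs) (j # js) = v $ j * tensor_of vs js"
  by (simp add: tensor_of_def prod.lessThan_Suc_shift del: prod.lessThan_Suc)

section \<open>Symmetric tensors\<close>

lemma permute_list_inv:
  assumes "\<sigma> permutes {..<length xs}"
  shows "permute_list \<sigma> (permute_list (inv \<sigma>) xs) = xs"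
    and "permute_list (inv \<sigma>) (permute_list \<sigma> xs) = xs"
  using assms permutes_inv [OF assms]
  by (simp_all flip: permute_list_compose add: permutes_inv_o)

lemma bij_betw_permute_list:
  assumes "\<sigma> permutes {..<n}"
  shows "bij_betw (permute_list \<sigma>) {xs. length xs = n} {xs. length xs = n}"
  using assms by (intro bij_betw_byWitness [where f' = "permute_list (inv \<sigma>)"])
    (auto simp: permute_list_inv)

lemma count_list_permute_list:
  "\<sigma> permutes {..<length xs} \<Longrightarrow> count_list (permute_list \<sigma> xs) = count_list xs"
  by (metis count_mset ext mset_permute_list)

lemma finite_lists_of_length [simp]: "finite {js :: 'n::finite list. length js = n}"
  using finite_lists_length_eq [of "UNIV :: 'n set" n] by simp

lemma tensor_of_permute_list:
  assumes "\<sigma> permutes {..<length vs}"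
  shows "tensor_of (permute_list \<sigma> vs) (permute_list \<sigma> js) = tensor_of vs js"
proof (cases "length js = length vs")
  case True
  have "(\<Prod>k<length vs. vs ! \<sigma> k $ (js ! \<sigma> k)) = (\<Prod>k<length vs. vs ! k $ (js ! k))"
    using prod.permute [OF assms, of "\<lambda>k. vs ! k $ (js ! k)"] by (simp add: o_def)
  then show ?thesis
    using assms True by (simp add: tensor_of_def permute_list_nth)
qed (simp add: tensor_of_def)

lemma tensor_of_axis:
  "tensor_of (map (\<lambda>j. axis j 1) js) ks = (if js = ks then 1 else 0)"
proof (cases "length ks = length js")
  case True
  show ?thesis
  proof (cases "js = ks")
    case False
    with True obtain k where "k < length js" "js ! k \<noteq> ks ! k"
      by (metis nth_equalityI)
    then show ?thesis
      using True False by (auto simp: tensor_of_def axis_def intro!: prod_zero bexI [of _ k])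
  qed (simp add: tensor_of_def axis_def)
qed (auto simp: tensor_of_def)

text \<open>Words with equal letter counts are permutations of each other, so a symmetric tensor is the same thing as a
function of the letter counts.\<close>

lemma sym_tensors_count_list_cong:
  assumes "t \<in> sym_tensors n" "count_list js = count_list ks"
  shows "t js = t ks"
proof -
  have "mset js = mset ks"
    using assms(2) by (intro multiset_eqI) (simp add: count_mset)
  then obtain \<sigma> where "\<sigma> permutes {..<length js}" "permute_list \<sigma> js = ks"
    by (metis mset_eq_permutation)
  with assms(1) show ?thesis
    by (cases "length js = n") (auto simp: sym_tensors_def)
qed

lemma count_list_cong_sym_tensors:
  "(\<lambda>js. if length js = n then f (count_list js) else 0) \<in> sym_tensors n"
  by (simp add: sym_tensors_def count_list_permute_list)

lemma sym_tensor_of_in_sym_tensors: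
  "sym_tensor_of vs \<in> sym_tensors (length vs)"
proof -
  let ?P = "{\<sigma>. \<sigma> permutes {..<length vs}}"
  have "sym_tensor_of vs (permute_list \<tau> js) = sym_tensor_of vs js"
    if \<tau>: "\<tau> permutes {..<length vs}" for js \<tau>
  proof -
    have "(\<Sum>\<sigma>\<in>?P. tensor_of (permute_list \<sigma> vs) (permute_list \<tau> js))
        = (\<Sum>\<sigma>\<in>?P. tensor_of (permute_list (\<sigma> \<circ> \<tau>) vs) (permute_list \<tau> js))"
      by (rule sum_permutations_compose_right [OF \<tau>])
    also have "\<dots> = (\<Sum>\<sigma>\<in>?P. tensor_of (permute_list \<sigma> vs) js)"
      using \<tau> by (intro sum.cong refl) (simp add: permute_list_compose tensor_of_permute_list)
    finally show ?thesis by (simp add: sym_tensor_of_def)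
  qed
  moreover have "sym_tensor_of vs js = 0" if "length js \<noteq> length vs" for js
    using that by (simp add: sym_tensor_of_def tensor_of_def)
  ultimately show ?thesis by (simp add: sym_tensors_def)
qed

lemma sym_tensors_add:
  "s \<in> sym_tensors n \<Longrightarrow> t \<in> sym_tensors n \<Longrightarrow> (\<lambda>js. s js + t js) \<in> sym_tensors n"
  by (simp add: sym_tensors_def)

lemma sym_tensors_scale: "t \<in> sym_tensors n \<Longrightarrow> (\<lambda>js. c * t js) \<in> sym_tensors n"
  by (simp add: sym_tensors_def)

lemma sym_tensors_sum:
  "(\<And>i. i \<in> A \<Longrightarrow> f i \<in> sym_tensors n) \<Longrightarrow> (\<lambda>js. \<Sum>i\<in>A. f i js) \<in> sym_tensors n"
  by (simp add: sym_tensors_def)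

text \<open>Symmetrising the expansion of \<open>t\<close> in the tensors of basis vectors gives \<open>t\<close> back.\<close>

lemma sym_tensor_expansion:
  fixes t :: "'n::finite tensor"
  assumes t: "t \<in> sym_tensors n"
  shows "t = (\<lambda>ks. \<Sum>js | length js = n. t js * sym_tensor_of (map (\<lambda>j. axis j 1) js) ks)"
proof
  fix ks :: "'n list"
  let ?S = "{js :: 'n list. length js = n}" and ?P = "{\<sigma>. \<sigma> permutes {..<n}}"
  have e: "sym_tensor_of (map (\<lambda>j. axis j 1) js) ks
      = (\<Sum>\<sigma>\<in>?P. if permute_list \<sigma> js = ks then 1 else 0) / fact n" if "js \<in> ?S" for js
    using that by (auto simp: sym_tensor_of_def tensor_of_axis permute_list_map
        intro!: sum.cong arg_cong [of _ _ "\<lambda>z. z / fact n"])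
  have "(\<Sum>js\<in>?S. t js * sym_tensor_of (map (\<lambda>j. axis j 1) js) ks)
      = (\<Sum>js\<in>?S. \<Sum>\<sigma>\<in>?P. t js * (if permute_list \<sigma> js = ks then 1 else 0)) / fact n"
    by (simp add: e sum_distrib_left sum_divide_distrib)
  also have "\<dots> = (\<Sum>\<sigma>\<in>?P. \<Sum>js\<in>?S. t js * (if permute_list \<sigma> js = ks then 1 else 0)) / fact n"
    by (subst sum.swap) (rule refl)
  also have "\<dots> = (\<Sum>\<sigma>\<in>?P. t ks) / fact n"
  proof (intro arg_cong [of _ _ "\<lambda>z. z / fact n"] sum.cong refl)
    fix \<sigma> assume "\<sigma> \<in> ?P"
    then have \<sigma>: "\<sigma> permutes {..<n}" by simp
    have "(\<Sum>js\<in>?S. t js * (if permute_list \<sigma> js = ks then 1 else 0))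
        = (\<Sum>js\<in>?S. t (permute_list \<sigma> js) * (if permute_list \<sigma> js = ks then 1 else 0))"
      using t \<sigma> by (intro sum.cong refl) (simp add: sym_tensors_def)
    also have "\<dots> = (\<Sum>js\<in>?S. t js * (if js = ks then 1 else 0))"
      by (rule sum.reindex_bij_betw [OF bij_betw_permute_list [OF \<sigma>]])
    also have "\<dots> = t ks"
      using t by (simp add: sum.delta' sym_tensors_def if_distrib cong: if_cong)
    finally show "(\<Sum>js\<in>?S. t js * (if permute_list \<sigma> js = ks then 1 else 0)) = t ks" .
  qed
  also have "\<dots> = t ks"
    by (simp add: card_permutations)
  finally show "t ks = (\<Sum>js\<in>?S. t js * sym_tensor_of (map (\<lambda>j. axis j 1) js) ks)" ..
qed

text \<open>The symmetrised products span the symmetric tensors, which yields the uniqueness part in the description of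
\<open>U\<^sub>n\<close>.\<close>

lemma sym_tensor_linear_eqI:
  fixes U V :: "'n::finite tensor \<Rightarrow> 'n polyC"
  assumes U: "\<And>s t. s \<in> sym_tensors n \<Longrightarrow> t \<in> sym_tensors n \<Longrightarrow> U (\<lambda>js. s js + t js) = U s + U t"
      "\<And>c t. t \<in> sym_tensors n \<Longrightarrow> U (\<lambda>js. c * t js) = Const c * U t"
    and V: "\<And>s t. s \<in> sym_tensors n \<Longrightarrow> t \<in> sym_tensors n \<Longrightarrow> V (\<lambda>js. s js + t js) = V s + V t"
      "\<And>c t. t \<in> sym_tensors n \<Longrightarrow> V (\<lambda>js. c * t js) = Const c * V t"
    and UV: "\<And>vs. length vs = n \<Longrightarrow> U (sym_tensor_of vs) = V (sym_tensor_of vs)"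
    and t: "t \<in> sym_tensors n"
  shows "U t = V t"
proof -
  let ?e = "\<lambda>js. sym_tensor_of (map (\<lambda>j. axis j 1) js) :: 'n tensor"
  have e: "?e js \<in> sym_tensors n" if "length js = n" for js
    using sym_tensor_of_in_sym_tensors [of "map (\<lambda>j. axis j 1) js"] that by simp
  have *: "W (\<lambda>ks. \<Sum>js\<in>A. t js * ?e js ks) = (\<Sum>js\<in>A. Const (t js) * W (?e js))"
    if W: "\<And>s t. s \<in> sym_tensors n \<Longrightarrow> t \<in> sym_tensors n \<Longrightarrow> W (\<lambda>js. s js + t js) = W s + W t"
      "\<And>c t. t \<in> sym_tensors n \<Longrightarrow> W (\<lambda>js. c * t js) = Const c * W t"
    and A: "finite A" "A \<subseteq> {js. length js = n}" for W :: "'n tensor \<Rightarrow> 'n polyC" and A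
    using A
  proof (induction A rule: finite_induct)
    case empty
    show ?case using W(2) [OF t, of 0] by (simp add: Const_def)
  next
    case (insert js A)
    then show ?case
      by (simp add: W e sym_tensors_scale sym_tensors_sum subset_iff)
  qed
  have "U (\<lambda>ks. \<Sum>js | length js = n. t js * ?e js ks) = V (\<lambda>ks. \<Sum>js | length js = n. t js * ?e js ks)"
    using UV by (simp add: * U V)
  then show ?thesis
    using sym_tensor_expansion [OF t] by simp
qed

section \<open>Jacobi sequences from an orthogonal basis with three-term recurrences\<close>

text \<open>An orthogonal family of polynomials, indexed by multi-indices, on which each \<open>X\<^sub>j\<close> acts by a monic three-term
recurrence in the \<open>j\<close>-th index. For a product measure, the products of monic orthogonal polynomials in one variable are of this kind. The
vanishing of \<open>c\<close> at \<open>m j = 0\<close> removes the term whose index \<open>m j - 1\<close> would be truncated. That \<open>L m\<close> has degree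
\<open>|m|\<close> and that the family spans all polynomials are consequences of the recurrence.\<close>

locale orthogonal_recurrence_basis =
  fixes M :: "(real ^ 'n::finite) measure"
    and L :: "('n \<Rightarrow> nat) \<Rightarrow> 'n polyC"
    and h :: "('n \<Rightarrow> nat) \<Rightarrow> complex"
    and b c :: "'n \<Rightarrow> ('n \<Rightarrow> nat) \<Rightarrow> complex"
  assumes integrable_eval: "\<And>p q. integrable M (\<lambda>x. cnj (eval_poly p x) * eval_poly q x)"
    and inner_L: "\<And>m m'. inner_mu M (L m) (L m') = (if m = m' then h m else 0)"
    and h_nonzero: "\<And>m. h m \<noteq> 0"
    and L_zero: "L (\<lambda>_. 0) = 1"
    and Xvar_L: "\<And>j m. Xvar j * L m = L (m(j := Suc (m j))) + Const (b j m) * L m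
                    + Const (c j m) * L (m(j := m j - 1))"
    and c_zero: "\<And>j m. m j = 0 \<Longrightarrow> c j m = 0"
begin

lemma inner_add_right: "inner_mu M p (q + r) = inner_mu M p q + inner_mu M p r"
  by (simp add: inner_mu_def distrib_left integrable_eval)

lemma inner_add_left: "inner_mu M (q + r) p = inner_mu M q p + inner_mu M r p"
  by (simp add: inner_mu_def distrib_right integrable_eval)

lemma inner_Const_right: "inner_mu M p (Const a * q) = a * inner_mu M p q"
  by (simp add: inner_mu_def mult.left_commute)

lemma inner_Const_left: "inner_mu M (Const a * p) q = cnj a * inner_mu M p q"
  by (simp add: inner_mu_def mult.assoc)

lemma inner_zero_right [simp]: "inner_mu M p 0 = 0"
  by (simp add: inner_mu_def)

lemma inner_zero_left [simp]: "inner_mu M 0 p = 0"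
  by (simp add: inner_mu_def)

lemma inner_diff_right: "inner_mu M p (q - r) = inner_mu M p q - inner_mu M p r"
  using inner_add_right [of p "q - r" r] by (simp add: algebra_simps)

lemma inner_sum_right: "inner_mu M p (sum f A) = (\<Sum>i\<in>A. inner_mu M p (f i))"
  by (induction A rule: infinite_finite_induct) (auto simp: inner_add_right)

lemma inner_sum_left: "inner_mu M (sum f A) p = (\<Sum>i\<in>A. inner_mu M (f i) p)"
  by (induction A rule: infinite_finite_induct) (auto simp: inner_add_left)

text \<open>The Fourier expansion truncated to the indices in \<open>A\<close>. With \<open>A = {m. |m| = n}\<close> this is the orthogonal projection,
with \<open>A = {m. |m| \<le> n}\<close> it fixes the polynomials of degree at most \<open>n\<close>, and
\<open>expansion A p = p\<close> expresses that \<open>p\<close> is in the span of the \<open>L m\<close> with \<open>m \<in> A\<close>, for finite \<open>A\<close>.\<close>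

definition expansion :: "('n \<Rightarrow> nat) set \<Rightarrow> 'n polyC \<Rightarrow> 'n polyC" where
  "expansion A p = (\<Sum>m\<in>A. Const (inner_mu M (L m) p / h m) * L m)"

lemma expansion_add: "expansion A (p + q) = expansion A p + expansion A q"
  by (simp add: expansion_def inner_add_right add_divide_distrib Const_add distrib_right sum.distrib)

lemma expansion_Const: "expansion A (Const a * p) = Const a * expansion A p"
  by (simp add: expansion_def inner_Const_right sum_distrib_left Const_mult mult.assoc
      flip: times_divide_eq_right)

lemma expansion_zero [simp]: "expansion A 0 = 0"
  by (simp add: expansion_def)

lemma expansion_sum: "expansion A (sum f B) = (\<Sum>i\<in>B. expansion A (f i))"
  by (induction B rule: infinite_finite_induct) (auto simp: expansion_add)

lemma expansion_L: "finite A \<Longrightarrow> expansion A (L m) = (if m \<in> A then L m else 0)"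
  using h_nonzero [of m]
  by (auto simp: expansion_def inner_L if_distrib if_distribR sum.delta cong: if_cong)

lemma inner_L_expansion:
  "finite A \<Longrightarrow> inner_mu M (L m) (expansion A p) = (if m \<in> A then inner_mu M (L m) p else 0)"
proof -
  have "inner_mu M (L m) (expansion A p) = (\<Sum>k\<in>A. if k = m then inner_mu M (L m) p else 0)"
    unfolding expansion_def inner_sum_right inner_Const_right
    using h_nonzero by (intro sum.cong refl) (simp add: inner_L)
  then show "finite A \<Longrightarrow> ?thesis" by simp
qed

text \<open>Solve the recurrence for its leading term: with \<open>m = k + e\<^sub>j\<close>, the polynomial \<open>L m\<close> is \<open>X\<^sub>j L k\<close> minus multiples
of members with smaller total degree.\<close>

lemma L_in_polys_upto: "L m \<in> polys_upto (int (total m))"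
proof (induction m rule: measure_induct_rule [of "\<lambda>m. total m"])
  case (less m)
  show ?case
  proof (cases "\<exists>j. m j \<noteq> 0")
    case False
    then have "m = (\<lambda>_. 0)" by auto
    then show ?thesis
      using Const_in_polys_upto [of 1] by (simp add: L_zero)
  next
    case True
    then obtain j where j: "m j \<noteq> 0" ..
    define k where "k = m(j := m j - 1)"
    have m: "m = k(j := Suc (k j))" and deg: "total m = Suc (total k)"
      using j total_fun_upd_pred [of m j] by (auto simp: k_def)
    have k: "L k \<in> polys_upto (int (total k))"
      using less deg by simp
    have "Const (- c j k) * L (k(j := k j - 1)) \<in> polys_upto (int (total k))"
    proof (cases "k j = 0")
      case False
      from total_fun_upd_pred [of k j, OF this] deg
      have lt: "total (k(j := k j - 1)) < total k"
        by simp
      then have "L (k(j := k j - 1)) \<in> polys_upto (int (total (k(j := k j - 1))))"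
        using deg lt by (intro less) linarith
      then show ?thesis
        using lt by (intro Const_mult_polys_upto) (erule polys_upto_mono, simp)
    qed (simp add: c_zero)
    moreover have "Const (- b j k) * L k \<in> polys_upto (int (total k))"
      by (intro Const_mult_polys_upto k)
    ultimately have "Xvar j * L k + (Const (- b j k) * L k + Const (- c j k) * L (k(j := k j - 1)))
        \<in> polys_upto (int (total m))"
      using polys_upto_mult [OF Xvar_in_polys_upto [of j] k] deg
      by (intro polys_upto_add) (auto elim: polys_upto_mono)
    moreover have "Xvar j * L k + (Const (- b j k) * L k + Const (- c j k) * L (k(j := k j - 1))) = L m"
      using m by (simp add: Xvar_L Const_def single_uminus)
    ultimately show ?thesis by simp
  qed
qed

text \<open>The induction step for spanning: multiplication by \<open>X\<^sub>j\<close> raises the total degree of the members involved by at most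
one.\<close>

lemma expansion_Xvar_mult:
  assumes "expansion {m. total m \<le> k} p = p"
  shows "expansion {m. total m \<le> Suc k} (Xvar j * p) = Xvar j * p"
proof -
  let ?E = "expansion {m. total m \<le> Suc k}"
  have L: "?E (Xvar j * L m) = Xvar j * L m" if "total m \<le> k" for m
  proof -
    have "?E (Const (c j m) * L (m(j := m j - 1))) = Const (c j m) * L (m(j := m j - 1))"
      using that total_fun_upd_pred [of m j]
      by (cases "m j = 0") (simp_all add: c_zero expansion_Const expansion_L)
    then show ?thesis
      using that by (simp add: Xvar_L expansion_add expansion_Const expansion_L total_fun_upd_Suc)
  qed
  have p: "p = (\<Sum>m | total m \<le> k. Const (inner_mu M (L m) p / h m) * L m)"
    using assms by (simp add: expansion_def)
  have X: "Xvar j * p = (\<Sum>m | total m \<le> k. Const (inner_mu M (L m) p / h m) * (Xvar j * L m))"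
    by (subst p) (simp add: sum_distrib_left mult.left_commute)
  show ?thesis
    unfolding X by (simp add: expansion_sum expansion_Const L)
qed

lemma expansion_monomial:
  assumes "total (Poly_Mapping.lookup m) = k"
  shows "expansion {m. total m \<le> k} (Poly_Mapping.single m 1) = Poly_Mapping.single m 1"
  using assms
proof (induction k arbitrary: m)
  case 0
  then have "m = 0" by (simp add: total_eq_0_iff poly_mapping_eq_iff zero_poly_mapping.rep_eq)
  then have "Poly_Mapping.single m (1::complex) = L (\<lambda>_. 0)"
    by (simp add: L_zero)
  then show ?case by (simp add: expansion_L)
next
  case (Suc k)
  then have "Poly_Mapping.lookup m \<noteq> (\<lambda>_. 0)"
    by (metis total_eq_0_iff nat.distinct(1))
  then obtain j where j: "Poly_Mapping.lookup m j \<noteq> 0"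
    by auto
  define m' where "m' = m - Poly_Mapping.single j 1"
  have m: "m = Poly_Mapping.single j 1 + m'"
    using j by (intro poly_mapping_eqI) (auto simp: m'_def lookup_add lookup_minus lookup_single when_def)
  have "Poly_Mapping.lookup m' = (Poly_Mapping.lookup m)(j := Poly_Mapping.lookup m j - 1)"
    by (auto simp: m'_def lookup_minus lookup_single when_def)
  with j Suc.prems total_fun_upd_pred [of "Poly_Mapping.lookup m" j]
  have "total (Poly_Mapping.lookup m') = k"
    by simp
  with Suc.IH have "expansion {m. total m \<le> k} (Poly_Mapping.single m' 1) = Poly_Mapping.single m' 1"
    by blast
  then show ?case
    using expansion_Xvar_mult [of k "Poly_Mapping.single m' 1" j] by (simp add: m Xvar_def mult_single)
qed

lemma expansion_mono:
  assumes "expansion A p = p" "A \<subseteq> B" "finite B"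
  shows "expansion B p = p"
proof -
  have "finite A" using assms by (rule_tac finite_subset)
  then have "expansion B (expansion A p) = expansion A p"
    unfolding expansion_def [of A] using assms(2,3)
    by (auto simp: expansion_sum expansion_Const expansion_L intro!: sum.cong)
  then show ?thesis by (simp add: assms(1))
qed

lemma expansion_polys_upto:
  assumes "p \<in> polys_upto (int k)"
  shows "expansion {m. total m \<le> k} p = p"
proof -
  have "expansion {m. total m \<le> k}
      (\<Sum>m\<in>Poly_Mapping.keys p. Const (Poly_Mapping.lookup p m) * Poly_Mapping.single m 1)
      = (\<Sum>m\<in>Poly_Mapping.keys p. Const (Poly_Mapping.lookup p m) * Poly_Mapping.single m 1)"
    unfolding expansion_sum expansion_Const
  proof (intro sum.cong refl arg_cong [of _ _ "(*) _"])
    fix m assume "m \<in> Poly_Mapping.keys p"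
    then have "total (Poly_Mapping.lookup m) \<le> k"
      using assms by (simp add: polys_upto_def total_def flip: of_nat_sum)
    then show "expansion {m. total m \<le> k} (Poly_Mapping.single m 1) = Poly_Mapping.single m 1"
      by (intro expansion_mono [OF expansion_monomial [OF refl]]) auto
  qed
  then show ?thesis
    by (simp add: Const_def mult_single poly_mapping_sum_singles)
qed

text \<open>Polynomials of smaller degree are combinations of members with smaller index, all orthogonal to \<open>L m\<close>. For
\<open>|m| = 0\<close> only the zero polynomial has degree at most \<open>-1\<close>.\<close>

lemma inner_L_lower_degree:
  assumes "q \<in> polys_upto (int (total m) - 1)"
  shows "inner_mu M q (L m) = 0"
proof (cases "total m")
  case 0
  then show ?thesis using assms polys_upto_neg [of "-1" q] by simp
next
  case (Suc k)
  with assms have "q = expansion {l. total l \<le> k} q"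
    by (simp add: expansion_polys_upto)
  also have "inner_mu M \<dots> (L m) = 0"
    using Suc by (auto simp: expansion_def inner_sum_left inner_Const_left inner_L intro!: sum.neutral)
  finally show ?thesis .
qed

lemma ortho_polys_iff: "p \<in> ortho_polys M n \<longleftrightarrow> expansion {m. total m = n} p = p"
proof
  assume p: "p \<in> ortho_polys M n"
  have "inner_mu M (L m) p = 0" if "total m < n" for m
    using p that polys_upto_mono [OF L_in_polys_upto [of m], of "int n - 1"]
    by (simp add: ortho_polys_def)
  then have "expansion {m. total m \<le> n} p = expansion {m. total m = n} p"
    unfolding expansion_def by (intro sum.mono_neutral_right) auto
  then show "expansion {m. total m = n} p = p"
    using p by (simp add: ortho_polys_def expansion_polys_upto)
next
  assume eq: "expansion {m. total m = n} p = p"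
  have "expansion {m. total m = n} p \<in> polys_upto (int n)"
    unfolding expansion_def
    by (auto intro!: polys_upto_sum Const_mult_polys_upto intro: polys_upto_mono [OF L_in_polys_upto])
  moreover have "inner_mu M q (expansion {m. total m = n} p) = 0" if "q \<in> polys_upto (int n - 1)" for q
    using that
    by (auto simp: expansion_def inner_sum_right inner_Const_right inner_L_lower_degree intro!: sum.neutral)
  ultimately show "p \<in> ortho_polys M n"
    by (simp add: ortho_polys_def eq)
qed

lemma ortho_proj_eq_expansion: "ortho_proj M n p = expansion {m. total m = n} p"
  unfolding ortho_proj_def
proof (rule the_equality)
  let ?E = "expansion {m. total m = n}"
  have "?E (?E p) = ?E p"
    unfolding expansion_def [of _ p] by (simp add: expansion_sum expansion_Const expansion_L)
  moreover have "inner_mu M (?E r) (p - ?E p) = 0" for r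
    by (auto simp: expansion_def [of _ r] inner_sum_left inner_Const_left inner_diff_right
        inner_L_expansion intro!: sum.neutral)
  ultimately show "?E p \<in> ortho_polys M n \<and> (\<forall>r\<in>ortho_polys M n. inner_mu M r (p - ?E p) = 0)"
    by (metis ortho_polys_iff)
  fix q assume q: "q \<in> ortho_polys M n \<and> (\<forall>r\<in>ortho_polys M n. inner_mu M r (p - q) = 0)"
  have "inner_mu M (L m) q = inner_mu M (L m) p" if "total m = n" for m
    using q that ortho_polys_iff [of "L m" n] by (simp add: expansion_L inner_diff_right)
  then have "?E q = ?E p" by (simp add: expansion_def)
  with q show "q = ?E p" by (simp add: ortho_polys_iff)
qed

lemma ortho_proj_ortho_polys:
  assumes "p \<in> ortho_polys M n"
  shows "ortho_proj M k p = (if k = n then p else 0)"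
proof -
  have "expansion {m. total m = k} (expansion {m. total m = n} p)
      = (if k = n then expansion {m. total m = n} p else 0)"
    unfolding expansion_def [of _ p] by (simp add: expansion_sum expansion_Const expansion_L)
  then show ?thesis
    using assms by (simp add: ortho_polys_iff ortho_proj_eq_expansion)
qed

lemma L_in_ortho_polys: "L m \<in> ortho_polys M (total m)"
  by (simp add: ortho_polys_iff expansion_L)

lemma ortho_proj_L: "ortho_proj M k (L m) = (if k = total m then L m else 0)"
  by (rule ortho_proj_ortho_polys [OF L_in_ortho_polys])

text \<open>Of the three terms of the recurrence only the first has total degree \<open>|m| + 1\<close>. This is the action of the creation
operator on the basis.\<close>

lemma ortho_proj_Suc_Xvar_L:
  "ortho_proj M (Suc (total m)) (Xvar j * L m) = L (m(j := Suc (m j)))"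
proof -
  have "Const (c j m) * ortho_proj M (Suc (total m)) (L (m(j := m j - 1))) = 0"
    using total_fun_upd_pred [of m j] by (cases "m j = 0") (auto simp: c_zero ortho_proj_L)
  then show ?thesis
    by (simp add: Xvar_L ortho_proj_eq_expansion expansion_add expansion_Const expansion_L
        total_fun_upd_Suc)
qed

lemma ortho_proj_Xvar_L:
  "ortho_proj M (total m) (Xvar j * L m) = Const (b j m) * L m"
proof -
  have "Const (c j m) * ortho_proj M (total m) (L (m(j := m j - 1))) = 0"
    using total_fun_upd_pred [of m j] by (cases "m j = 0") (auto simp: c_zero ortho_proj_L)
  then show ?thesis
    by (simp add: Xvar_L ortho_proj_eq_expansion expansion_add expansion_Const expansion_L
        total_fun_upd_Suc)
qed

lemma a_zero_axis_L:
  "a_zero M (axis j 1) (total m) (L m) = Const (b j m) * L m"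
proof -
  have "Xvec (axis j 1) = Xvar j"
    by (simp add: Xvec_def axis_def if_distrib if_distribR sum.delta cong: if_cong)
  then show ?thesis
    by (simp add: a_zero_def ortho_proj_L ortho_proj_Xvar_L)
qed

text \<open>On a polynomial of the \<open>n\<close>-th space all projections but the \<open>n\<close>-th vanish, so one term of the series survives.\<close>

lemma a_plus_ortho_polys:
  assumes "p \<in> ortho_polys M n"
  shows "a_plus M v p = (\<Sum>j\<in>UNIV. Const (v $ j) * ortho_proj M (Suc n) (Xvar j * p))"
proof -
  have "a_plus M v p = ortho_proj M (Suc n) (Xvec v * p)"
    unfolding a_plus_def ortho_proj_ortho_polys [OF assms]
    by (subst Sum_any.expand_superset [of "{n}"]) (auto simp: ortho_proj_eq_expansion split: if_splits)
  then show ?thesis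
    by (simp add: Xvec_def sum_distrib_right ortho_proj_eq_expansion expansion_sum
        expansion_Const mult.assoc)
qed

text \<open>The explicit form of \<open>U\<^sub>n\<close>. It is defined on all tensors, not only symmetric ones, because the unsymmetrised
tensor of a word is easier to follow through the creation operators.\<close>

definition fock_map :: "nat \<Rightarrow> 'n tensor \<Rightarrow> 'n polyC" where
  "fock_map n t = (\<Sum>js | length js = n. Const (t js) * L (count_list js))"

lemma fock_map_in_ortho_polys: "fock_map n t \<in> ortho_polys M n"
  by (auto simp: ortho_polys_iff fock_map_def expansion_sum expansion_Const expansion_L
      total_count_list intro!: sum.cong)

lemma fock_map_add: "fock_map n (\<lambda>js. s js + t js) = fock_map n s + fock_map n t"
  by (simp add: fock_map_def Const_add distrib_right sum.distrib)

lemma fock_map_scale: "fock_map n (\<lambda>js. a * t js) = Const a * fock_map n t"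
  by (simp add: fock_map_def Const_mult sum_distrib_left mult.assoc)

lemma fock_map_sum: "fock_map n (\<lambda>js. \<Sum>i\<in>A. f i js) = (\<Sum>i\<in>A. fock_map n (f i))"
  unfolding fock_map_def Const_sum sum_distrib_right by (rule sum.swap)

text \<open>Permuting the factors of a tensor permutes the words in its coordinates, and \<open>L (count_list js)\<close> depends on letter
counts only.\<close>

lemma fock_map_permute:
  assumes "\<sigma> permutes {..<length vs}"
  shows "fock_map (length vs) (tensor_of (permute_list \<sigma> vs)) = fock_map (length vs) (tensor_of vs)"
proof -
  have "fock_map (length vs) (tensor_of (permute_list \<sigma> vs))
      = (\<Sum>js | length js = length vs. Const (tensor_of (permute_list \<sigma> vs) (permute_list \<sigma> js))
           * L (count_list (permute_list \<sigma> js)))"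
    unfolding fock_map_def
    by (rule sum.reindex_bij_betw [OF bij_betw_permute_list [OF assms], symmetric])
  also have "\<dots> = fock_map (length vs) (tensor_of vs)"
    using assms unfolding fock_map_def
    by (intro sum.cong refl) (simp add: tensor_of_permute_list count_list_permute_list)
  finally show ?thesis .
qed

lemma fock_map_sym_tensor_of:
  "fock_map (length vs) (sym_tensor_of vs) = fock_map (length vs) (tensor_of vs)"
proof -
  let ?n = "length vs" and ?P = "{\<sigma>. \<sigma> permutes {..<length vs}}"
  have "sym_tensor_of vs
      = (\<lambda>js. inverse (fact ?n) * (\<Sum>\<sigma>\<in>?P. tensor_of (permute_list \<sigma> vs) js))"
    by (auto simp: sym_tensor_of_def divide_inverse)
  then have "fock_map ?n (sym_tensor_of vs)
      = Const (inverse (fact ?n)) * (\<Sum>\<sigma>\<in>?P. fock_map ?n (tensor_of (permute_list \<sigma> vs)))"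
    by (simp only: fock_map_scale fock_map_sum)
  also have "(\<Sum>\<sigma>\<in>?P. fock_map ?n (tensor_of (permute_list \<sigma> vs))) = (\<Sum>\<sigma>\<in>?P. fock_map ?n (tensor_of vs))"
    by (intro sum.cong refl) (simp add: fock_map_permute)
  also have "\<dots> = Const (fact ?n) * fock_map ?n (tensor_of vs)"
    by (simp add: card_permutations Const_def flip: single_of_nat)
  finally show ?thesis
    by (simp flip: mult.assoc Const_mult)
qed

text \<open>By multilinearity the creation operators along \<open>vs\<close> act as a sum over words, and each letter \<open>j\<close> moves
\<open>L m\<close> to \<open>L (m + e\<^sub>j)\<close>.\<close>

lemma foldr_a_plus: "foldr (a_plus M) vs 1 = fock_map (length vs) (tensor_of vs)"
proof (induction vs)
  case Nil
  have "{js :: 'n list. js = []} = {[]}" by auto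
  moreover have "L (count_list []) = 1"
    using L_zero by (simp add: fun_eq_iff [THEN iffD2, of "count_list []" "\<lambda>_. 0"])
  ultimately show ?case by (simp add: fock_map_def tensor_of_def)
next
  case (Cons v vs)
  let ?S = "{js :: 'n list. length js = length vs}"
  have "foldr (a_plus M) (v # vs) 1
      = (\<Sum>j\<in>UNIV. Const (v $ j) *
           ortho_proj M (Suc (length vs)) (Xvar j * fock_map (length vs) (tensor_of vs)))"
    by (simp add: Cons a_plus_ortho_polys [OF fock_map_in_ortho_polys])
  also have "\<dots> = (\<Sum>j\<in>UNIV. \<Sum>js\<in>?S. Const (tensor_of (v # vs) (j # js)) * L (count_list (j # js)))"
  proof (intro sum.cong refl)
    fix j
    have "ortho_proj M (Suc (length vs)) (Xvar j * fock_map (length vs) (tensor_of vs))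
        = (\<Sum>js\<in>?S. Const (tensor_of vs js) * ortho_proj M (Suc (length vs)) (Xvar j * L (count_list js)))"
      by (simp add: fock_map_def sum_distrib_left ortho_proj_eq_expansion expansion_sum
          expansion_Const mult.left_commute [of "Xvar j"])
    also have "\<dots> = (\<Sum>js\<in>?S. Const (tensor_of vs js) * L (count_list (j # js)))"
    proof (intro sum.cong refl)
      fix js assume js: "js \<in> ?S"
      have "count_list (j # js) = (count_list js)(j := Suc (count_list js j))" by auto
      then show "Const (tensor_of vs js) * ortho_proj M (Suc (length vs)) (Xvar j * L (count_list js))
          = Const (tensor_of vs js) * L (count_list (j # js))"
        using ortho_proj_Suc_Xvar_L [of "count_list js" j] js by (simp only: total_count_list) simp
    qed
    finally show "Const (v $ j) *
          ortho_proj M (Suc (length vs)) (Xvar j * fock_map (length vs) (tensor_of vs))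
        = (\<Sum>js\<in>?S. Const (tensor_of (v # vs) (j # js)) * L (count_list (j # js)))"
      by (simp add: sum_distrib_left tensor_of_Cons Const_mult mult.assoc)
  qed
  also have "\<dots> = fock_map (length (v # vs)) (tensor_of (v # vs))"
    by (simp add: fock_map_def sum_lists_Suc)
  finally show ?case .
qed

text \<open>The words with the letter counts of \<open>ks\<close> contribute equally for a symmetric tensor. Hence the coordinate at \<open>ks\<close>
can be read off, which gives injectivity.\<close>

lemma inner_L_fock_map:
  assumes t: "t \<in> sym_tensors n" and ks: "length ks = n"
  shows "inner_mu M (L (count_list ks)) (fock_map n t)
      = h (count_list ks) * of_nat (card {js. length js = n \<and> count_list js = count_list ks}) * t ks"
proof -
  have "inner_mu M (L (count_list ks)) (fock_map n t)
      = (\<Sum>js | length js = n. if count_list js = count_list ks then h (count_list ks) * t ks else 0)"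
    unfolding fock_map_def inner_sum_right inner_Const_right
  proof (intro sum.cong refl)
    fix js
    show "t js * inner_mu M (L (count_list ks)) (L (count_list js))
        = (if count_list js = count_list ks then h (count_list ks) * t ks else 0)"
      using sym_tensors_count_list_cong [OF t, of js ks]
      by (cases "count_list js = count_list ks") (simp_all add: inner_L)
  qed
  then show ?thesis
    by (simp add: sum.If_cases Collect_conj_eq mult.commute)
qed

text \<open>For surjectivity, the coefficient of \<open>L m\<close> is distributed evenly over the words with letter counts \<open>m\<close>; by
\<open>ex_list_with_counts\<close> there is at least one.\<close>

lemma bij_betw_fock_map: "bij_betw (fock_map n) (sym_tensors n) (ortho_polys M n)"
proof -
  let ?K = "\<lambda>m. {js :: 'n list. length js = n \<and> count_list js = m}"
  have fin: "finite (?K m)" for m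
    by (rule finite_subset [OF _ finite_lists_of_length [of n]]) auto
  have K: "card (?K m) \<noteq> 0" if "total m = n" for m
    using ex_list_with_counts [of m] that fin by (auto simp: total_count_list)
  have inj: "s = t" if s: "s \<in> sym_tensors n" and t: "t \<in> sym_tensors n"
    and eq: "fock_map n s = fock_map n t" for s t
  proof
    fix ks
    show "s ks = t ks"
    proof (cases "length ks = n")
      case True
      then show ?thesis
        using inner_L_fock_map [OF s True] inner_L_fock_map [OF t True] eq h_nonzero
          K [of "count_list ks"] by (auto simp: total_count_list)
    next
      case False
      then show ?thesis using s t by (simp add: sym_tensors_def)
    qed
  qed
  have surj: "\<exists>t\<in>sym_tensors n. p = fock_map n t" if p: "p \<in> ortho_polys M n" for p
  proof
    let ?a = "\<lambda>m. inner_mu M (L m) p / h m"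
    let ?t = "\<lambda>js. if length js = n then ?a (count_list js) / of_nat (card (?K (count_list js))) else 0"
    show "?t \<in> sym_tensors n"
      by (rule count_list_cong_sym_tensors)
    have "fock_map n ?t = (\<Sum>js | length js = n.
        Const (?a (count_list js) / of_nat (card (?K (count_list js)))) * L (count_list js))"
      unfolding fock_map_def by (intro sum.cong) auto
    also have "\<dots> = (\<Sum>m | total m = n. \<Sum>js\<in>{js \<in> {js. length js = n}. count_list js = m}.
        Const (?a (count_list js) / of_nat (card (?K (count_list js)))) * L (count_list js))"
      by (rule sum.group [symmetric]) (auto simp: total_count_list)
    also have "\<dots> = (\<Sum>m | total m = n. of_nat (card (?K m)) * (Const (?a m / of_nat (card (?K m))) * L m))"
      by (intro sum.cong refl) simp
    also have "\<dots> = (\<Sum>m | total m = n. Const (?a m) * L m)"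
    proof (intro sum.cong refl)
      fix m :: "'n \<Rightarrow> nat" assume "m \<in> {m. total m = n}"
      with K [of m] have "Const (of_nat (card (?K m)) * (?a m / of_nat (card (?K m)))) = (Const (?a m) :: 'n polyC)"
        by simp
      then show "of_nat (card (?K m)) * (Const (?a m / of_nat (card (?K m))) * L m) = Const (?a m) * L m"
        by (simp only: Const_mult Const_of_nat flip: mult.assoc)
    qed
    also have "\<dots> = p"
      using p by (simp add: ortho_polys_iff expansion_def)
    finally show "p = fock_map n ?t" ..
  qed
  show ?thesis
    unfolding bij_betw_def inj_on_def using inj surj fock_map_in_ortho_polys by blast
qed

lemma fock_iso_eq: "t \<in> sym_tensors n \<Longrightarrow> fock_iso M n t = fock_map n t"
proof -
  have "fock_iso M n = restrict (fock_map n) (sym_tensors n)"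
    unfolding fock_iso_def
  proof (rule the_equality, goal_cases)
    case 1
    have "sym_tensor_of vs \<in> sym_tensors n" if "length vs = n" for vs :: "(complex^'n) list"
      using sym_tensor_of_in_sym_tensors [of vs] that by simp
    then show ?case
      using bij_betw_fock_map [of n]
      by (auto simp: fock_map_add fock_map_scale sym_tensors_add sym_tensors_scale foldr_a_plus
          fock_map_sym_tensor_of cong: bij_betw_cong)
  next
    case (2 U)
    show ?case
    proof (rule extensionalityI [of _ "sym_tensors n"])
      fix t :: "'n tensor" assume t: "t \<in> sym_tensors n"
      have "U t = fock_map n t"
      proof (rule sym_tensor_linear_eqI [OF _ _ fock_map_add fock_map_scale _ t])
        show "U (sym_tensor_of vs) = fock_map n (sym_tensor_of vs)" if "length vs = n" for vs
          using 2 that by (auto simp: foldr_a_plus fock_map_sym_tensor_of)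
      qed (use 2 in auto)
      with t show "U t = restrict (fock_map n) (sym_tensors n) t" by simp
    qed (use 2 in auto)
  qed
  then show "t \<in> sym_tensors n \<Longrightarrow> fock_iso M n t = fock_map n t" by simp
qed

lemma basis_tensor_in_sym_tensors: "basis_tensor (cl js) \<in> sym_tensors (length js)"
  using sym_tensor_of_in_sym_tensors [of "map (\<lambda>j. axis j 1) js"] by (simp add: basis_tensor_cl)

lemma fock_iso_basis_tensor: "fock_iso M (length js) (basis_tensor (cl js)) = L (count_list js)"
proof -
  have "fock_iso M (length js) (basis_tensor (cl js))
      = fock_map (length js) (tensor_of (map (\<lambda>j. axis j 1) js))"
    using fock_map_sym_tensor_of [of "map (\<lambda>j. axis j 1) js"]
    by (simp add: fock_iso_eq basis_tensor_in_sym_tensors) (simp add: basis_tensor_cl)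
  also have "\<dots> = L (count_list js)"
    by (simp add: fock_map_def tensor_of_axis if_distrib if_distribR sum.delta cong: if_cong)
  finally show ?thesis .
qed

lemma jacobi_alpha_basis_tensor:
  "jacobi_alpha M (axis l 1) (length js) (basis_tensor (cl js))
     = (\<lambda>ks. b l (count_list js) * basis_tensor (cl js) ks)"
proof -
  let ?n = "length js" and ?t = "\<lambda>ks. b l (count_list js) * basis_tensor (cl js) ks"
  have t: "?t \<in> sym_tensors ?n"
    by (intro sym_tensors_scale basis_tensor_in_sym_tensors)
  have "a_zero M (axis l 1) ?n (fock_iso M ?n (basis_tensor (cl js)))
      = Const (b l (count_list js)) * fock_iso M ?n (basis_tensor (cl js))"
    using a_zero_axis_L [of l "count_list js"] by (simp add: fock_iso_basis_tensor total_count_list)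
  also have "\<dots> = fock_iso M ?n ?t"
    using t by (simp add: fock_iso_eq basis_tensor_in_sym_tensors fock_map_scale)
  finally have "jacobi_alpha M (axis l 1) ?n (basis_tensor (cl js))
      = inv_into (sym_tensors ?n) (fock_iso M ?n) (fock_iso M ?n ?t)"
    by (simp add: jacobi_alpha_def)
  also have "\<dots> = ?t"
  proof (rule inv_into_f_f [OF _ t])
    show "inj_on (fock_iso M ?n) (sym_tensors ?n)"
      using bij_betw_fock_map [of ?n] by (simp add: bij_betw_def fock_iso_eq cong: inj_on_cong)
  qed
  finally show ?thesis .
qed

text \<open>The tensor whose coordinate at a word is the scalar product of \<open>L (count_list js)\<close> with \<open>U\<^sub>n \<eta>\<close> satisfies the defining
equation. It is the only one, since the tensor scalar product is definite on the difference of two solutions.\<close>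

lemma tensor_inner_jacobi_Omega:
  assumes \<xi>: "\<xi> \<in> sym_tensors n"
  shows "tensor_inner n \<xi> (jacobi_Omega M n \<eta>) = inner_mu M (fock_iso M n \<xi>) (fock_iso M n \<eta>)"
proof -
  let ?q = "fock_iso M n \<eta>"
  let ?P = "\<lambda>\<zeta>. \<zeta> \<in> sym_tensors n \<and>
     (\<forall>\<xi>\<in>sym_tensors n. tensor_inner n \<xi> \<zeta> = inner_mu M (fock_iso M n \<xi>) ?q)"
  let ?\<zeta> = "\<lambda>js. if length js = n then inner_mu M (L (count_list js)) ?q else 0"
  have ex: "?P ?\<zeta>"
    using count_list_cong_sym_tensors
    by (auto simp: tensor_inner_def fock_iso_eq fock_map_def inner_sum_left inner_Const_left
        intro!: sum.cong)
  \<comment> \<open>Test both equations on the difference itself; its squared norm then vanishes.\<close>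
  have uniq: "\<zeta> = \<zeta>'" if \<zeta>: "?P \<zeta>" and \<zeta>': "?P \<zeta>'" for \<zeta> \<zeta>'
  proof
    fix ks
    let ?d = "\<lambda>js. \<zeta> js - \<zeta>' js"
    have d: "?d \<in> sym_tensors n" using \<zeta> \<zeta>' by (simp add: sym_tensors_def)
    have "tensor_inner n ?d \<zeta> - tensor_inner n ?d \<zeta>' = 0"
      using \<zeta> \<zeta>' d by simp
    then have "(\<Sum>js | length js = n. cnj (?d js) * ?d js) = 0"
      by (simp add: tensor_inner_def right_diff_distrib sum_subtractf)
    then have "of_real (\<Sum>js | length js = n. (cmod (?d js))\<^sup>2) = (0 :: complex)"
      by (simp add: complex_norm_square mult.commute del: of_real_power)
    then have "(\<Sum>js | length js = n. (cmod (?d js))\<^sup>2) = 0"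
      by (simp only: of_real_eq_0_iff)
    then have "\<forall>js\<in>{js. length js = n}. (cmod (?d js))\<^sup>2 = 0"
      by (subst (asm) sum_nonneg_eq_0_iff) auto
    then show "\<zeta> ks = \<zeta>' ks"
      using \<zeta> \<zeta>' by (cases "length ks = n") (auto simp: sym_tensors_def)
  qed
  have "?P (jacobi_Omega M n \<eta>)"
    unfolding jacobi_Omega_def by (rule theI [of ?P, OF ex]) (rule uniq [OF _ ex])
  with \<xi> show ?thesis by blast
qed

lemma Omega_coeff_eq:
  assumes "length ks = length js"
  shows "Omega_coeff M (length js) (cl ks) (cl js) = (if cl ks = cl js then h (count_list ks) else 0)"
proof -
  have "cl ks = cl js \<longleftrightarrow> count_list ks = count_list js"
    using assms by (auto simp: cl_def fun_eq_iff set_eq_iff)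
  then show ?thesis
    unfolding Omega_coeff_def
    using basis_tensor_in_sym_tensors [of ks] fock_iso_basis_tensor [of ks] assms
    by (simp add: tensor_inner_jacobi_Omega fock_iso_basis_tensor inner_L)
qed

end

section \<open>Products of Laguerre polynomials\<close>

definition laguerre_basis :: "('n \<Rightarrow> real) \<Rightarrow> ('n::finite \<Rightarrow> nat) \<Rightarrow> 'n polyC" where
  "laguerre_basis \<alpha> m = (\<Prod>j\<in>UNIV. poly_at_Xvar j (laguerre (\<alpha> j) (m j)))"

text \<open>Only the factor of the \<open>j\<close>-th variable takes part, and there this is \<open>laguerre_recurrence\<close>.\<close>

lemma Xvar_laguerre_basis:
  "Xvar j * laguerre_basis \<alpha> m = laguerre_basis \<alpha> (m(j := Suc (m j)))
     + Const (complex_of_real (2 * real (m j) + \<alpha> j + 1)) * laguerre_basis \<alpha> m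
     + Const (complex_of_real (real (m j) * (real (m j) + \<alpha> j))) * laguerre_basis \<alpha> (m(j := m j - 1))"
proof -
  let ?R = "\<Prod>i\<in>UNIV - {j}. poly_at_Xvar i (laguerre (\<alpha> i) (m i))"
  have split: "laguerre_basis \<alpha> (m(j := k)) = poly_at_Xvar j (laguerre (\<alpha> j) k) * ?R" for k
    by (simp add: laguerre_basis_def prod.remove [of UNIV j])
  have "Xvar j * laguerre_basis \<alpha> m = poly_at_Xvar j (monom 1 1 * laguerre (\<alpha> j) (m j)) * ?R"
    using split [of "m j"] by (simp only: poly_at_Xvar_monom_mult fun_upd_triv mult.assoc)
  also have "\<dots> = laguerre_basis \<alpha> (m(j := Suc (m j)))
     + Const (complex_of_real (2 * real (m j) + \<alpha> j + 1)) * laguerre_basis \<alpha> (m(j := m j))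
     + Const (complex_of_real (real (m j) * (real (m j) + \<alpha> j))) * laguerre_basis \<alpha> (m(j := m j - 1))"
    unfolding laguerre_recurrence poly_at_Xvar_add poly_at_Xvar_smult split by (simp only: distrib_right mult.assoc)
  finally show ?thesis by (simp only: fun_upd_triv)
qed

text \<open>The values of the polynomials are real and the integral factors over the coordinates.\<close>

lemma inner_laguerre_basis:
  assumes \<alpha>: "\<And>j. \<alpha> j > -1"
  shows "inner_mu (laguerre_measure \<alpha>) (laguerre_basis \<alpha> m) (laguerre_basis \<alpha> m')
    = (if m = m' then complex_of_real (\<Prod>j\<in>UNIV. fact (m j) * Gamma (real (m j) + \<alpha> j + 1)) else 0)"
proof -
  have "inner_mu (laguerre_measure \<alpha>) (laguerre_basis \<alpha> m) (laguerre_basis \<alpha> m')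
      = (\<integral>x. complex_of_real (\<Prod>j\<in>UNIV. poly (laguerre (\<alpha> j) (m j) * laguerre (\<alpha> j) (m' j)) (x $ j))
           \<partial>laguerre_measure \<alpha>)"
    by (simp add: inner_mu_def laguerre_basis_def prod.distrib)
  also have "\<dots> = complex_of_real (\<Prod>j\<in>UNIV.
      laguerre_functional (\<alpha> j) (laguerre (\<alpha> j) (m j) * laguerre (\<alpha> j) (m' j)))"
    by (rule has_bochner_integral_integral_eq [OF has_bochner_integral_laguerre_measure [OF \<alpha>]])
  also have "\<dots> = complex_of_real (\<Prod>j\<in>UNIV.
      if m j = m' j then fact (m' j) * Gamma (real (m' j) + \<alpha> j + 1) else 0)"
    by (simp only: laguerre_orthogonal [OF \<alpha>])
  also have "\<dots> = (if m = m' then complex_of_real (\<Prod>j\<in>UNIV. fact (m j) * Gamma (real (m j) + \<alpha> j + 1)) else 0)"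
    by (auto simp: fun_eq_iff intro!: prod_zero)
  finally show ?thesis .
qed

theorem theorem5p2:
  fixes \<alpha> :: "'n::finite \<Rightarrow> real" and n :: nat and ii jj :: "'n list"
  assumes "\<forall>l. \<alpha> l > -1"
    and "length ii = n" and "length jj = n"
  shows "let \<mu> = laguerre_measure \<alpha>;
             N = (\<lambda>l. card {k. k < n \<and> ii ! k = l})
         in (\<forall>l. jacobi_alpha \<mu> (axis l 1) n (basis_tensor (cl ii))
                   = (\<lambda>ks. complex_of_real (2 * real (N l) + \<alpha> l + 1) * basis_tensor (cl ii) ks))
          \<and> Omega_coeff \<mu> n (cl ii) (cl jj)
              = (if cl ii = cl jj then 1 else 0)
                * complex_of_real ((\<Prod>l\<in>UNIV. fact (N l)) * (\<Prod>l\<in>UNIV. Gamma (real (N l) + \<alpha> l + 1)))"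
proof -
  note \<alpha> = assms(1) [rule_format]
  let ?h = "\<lambda>m :: 'n \<Rightarrow> nat. complex_of_real (\<Prod>j\<in>UNIV. fact (m j) * Gamma (real (m j) + \<alpha> j + 1))"
  interpret orthogonal_recurrence_basis "laguerre_measure \<alpha>" "laguerre_basis \<alpha>" ?h
    "\<lambda>j m. complex_of_real (2 * real (m j) + \<alpha> j + 1)"
    "\<lambda>j m. complex_of_real (real (m j) * (real (m j) + \<alpha> j))"
  proof
    have "Gamma (real (m j) + \<alpha> j + 1) > 0" for m :: "'n \<Rightarrow> nat" and j
      using \<alpha> [of j] by (intro Gamma_real_pos) linarith
    then show "?h m \<noteq> 0" for m
      by (simp add: less_imp_neq [THEN not_sym])
    show "laguerre_basis \<alpha> (\<lambda>_. 0) = 1"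
      by (simp add: laguerre_basis_def)
    show "Xvar j * laguerre_basis \<alpha> m = laguerre_basis \<alpha> (m(j := Suc (m j)))
        + Const (complex_of_real (2 * real (m j) + \<alpha> j + 1)) * laguerre_basis \<alpha> m
        + Const (complex_of_real (real (m j) * (real (m j) + \<alpha> j))) * laguerre_basis \<alpha> (m(j := m j - 1))"
      for j m by (rule Xvar_laguerre_basis)
  qed (use \<alpha> in \<open>simp_all add: integrable_laguerre_measure_eval_poly inner_laguerre_basis\<close>)
  have N: "card {k. k < n \<and> ii ! k = l} = count_list ii l" for l
    using assms(2) by (simp add: count_list_eq_length_filter length_filter_conv_card conj_commute eq_commute)
  show ?thesis
    using jacobi_alpha_basis_tensor [of _ ii] Omega_coeff_eq [of ii jj] assms(2,3)
    by (simp add: N prod.distrib)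
qed

end
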